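(* Let $p$ be a prime number, let $f:A\rightarrow B$, $g:B\rightarrow C$, and $h:A\rightarrow \tilde A$ be $\mathbb{F}_p$-algebra maps, and let $\tilde B:=\tilde A\otimes_A B$. 1. The following are equivalent: (a) $f$ is $F$-finite, that is, $\Phi_1(A,B)$ is finite; (b) for any integer $e>0$, $\Phi_e(A,B)$ is finite; (c) for some integer $e>0$, $\Phi_e(A,B)$ is finite. 2. If $f$ and $g$ are $F$-finite, then so is $gf$. 3. If $gf$ is $F$-finite, then so is $g$. 4. The ring $A$ is $F$-finite (that is, the Frobenius map $F_A:A^{(1)}\rightarrow A$ is finite) if and only if the unique homomorphism $\mathbb{F}_p\rightarrow A$ is $F$-finite. 5. If $f:A\rightarrow B$ is $F$-finite, then the base change $\tilde f:\tilde A\rightarrow\tilde B$ is $F$-finite. 6. If the ring $B$ is $F$-finite, then $f$ is $F$-finite. 7. If the ring $A$ and the map $f$ are $F$-finite, then the ring $B$ is $F$-finite.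
   Context: All rings are commutative with identity; $p$ is a prime number. For an $\mathbb{F}_p$-algebra $A$ and an integer $e\geq 0$, $A^{(e)}$ denotes a copy of the ring $A$, with $a\in A$ written $a^{(e)}$ when viewed in $A^{(e)}$ (so $a^{(e)}b^{(e)}=(ab)^{(e)}$ and $a^{(e)}+b^{(e)}=(a+b)^{(e)}$), and $A=A^{(0)}$ is regarded as an $A^{(e)}$-algebra through the iterated Frobenius $a^{(e)}\mapsto a^{p^e}$; $F_A:A^{(1)}\to A$ is $a^{(1)}\mapsto a^p$. An $\mathbb{F}_p$-algebra map $f:A\to B$ makes $B^{(e)}$ an $A^{(e)}$-algebra via $a^{(e)}\mapsto f(a)^{(e)}$. The relative Frobenius (Radu–André) homomorphism is the ring map $\Phi_e(A,B):B^{(e)}\otimes_{A^{(e)}}A\rightarrow B$, $b^{(e)}\otimes a\mapsto b^{p^e}a$ (where $a$ acts through $f$). The map $A\to B$ is called $F$-finite (or $B$ is $F$-finite over $A$) if $\Phi_1(A,B)$ is finite, i.e. $B$ is a finitely generated $B^{(1)}\otimes_{A^{(1)}}A$-module through $\Phi_1(A,B)$. A ring map is finite if it makes the target a finitely generated module over the source. *)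

theory Defs
  imports "HOL-Algebra.QuotRing" "HOL-Algebra.Free_Abelian_Groups" "HOL-Number_Theory.Residues"
begin

section \<open>Finite ring maps\<close>

definition hom_module :: "('r \<Rightarrow> 's) \<Rightarrow> ('s, 'n) ring_scheme \<Rightarrow> ('r, 's) module" where
  "hom_module \<phi> S = \<lparr>carrier = carrier S, monoid.mult = (\<otimes>\<^bsub>S\<^esub>), one = \<one>\<^bsub>S\<^esub>,
     ring.zero = \<zero>\<^bsub>S\<^esub>, add = (\<oplus>\<^bsub>S\<^esub>), smult = \<lambda>r s. \<phi> r \<otimes>\<^bsub>S\<^esub> s\<rparr>"

definition fin_gen_module :: "('r, 'm) ring_scheme \<Rightarrow> ('r, 's, 'n) module_scheme \<Rightarrow> bool" where
  "fin_gen_module R M \<longleftrightarrow>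
     (\<exists>X. finite X \<and> X \<subseteq> carrier M \<and>
        (\<forall>m \<in> carrier M. \<exists>c \<in> X \<rightarrow> carrier R. m = (\<Oplus>\<^bsub>M\<^esub>x\<in>X. c x \<odot>\<^bsub>M\<^esub> x)))"

definition finite_ring_map ::
  "('r, 'm) ring_scheme \<Rightarrow> ('s, 'n) ring_scheme \<Rightarrow> ('r \<Rightarrow> 's) \<Rightarrow> bool" where
  "finite_ring_map R S \<phi> \<longleftrightarrow> fin_gen_module R (hom_module \<phi> S)"


section \<open>Tensor products of algebras\<close>

text \<open>The monoid ring \<open>\<int>[G]\<close>; its additive group is the free abelian group on \<open>carrier G\<close>.\<close>

definition int_monoid_ring :: "('g, 'm) monoid_scheme \<Rightarrow> ('g \<Rightarrow>\<^sub>0 int) ring" where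
  "int_monoid_ring G = \<lparr>carrier = carrier (free_Abelian_group (carrier G)),
     monoid.mult = \<lambda>x y. frag_extend (\<lambda>g. frag_extend (\<lambda>h. frag_of (g \<otimes>\<^bsub>G\<^esub> h)) y) x,
     one = frag_of \<one>\<^bsub>G\<^esub>, ring.zero = 0, add = (+)\<rparr>"

text \<open>\<open>S\<close> and \<open>T\<close> are \<open>R\<close>-algebras through \<open>\<phi>: R \<rightarrow> S\<close> and \<open>\<psi>: R \<rightarrow> T\<close>.  Additively,
  \<open>tensor_ring R S T \<phi> \<psi>\<close> is the usual quotient of the free abelian group on pairs by the
  subgroup generated by the bilinearity and balancing relations; that subgroup is an ideal of
  \<open>\<int>[S \<times> T]\<close>, and the quotient multiplication is \<open>(s \<otimes> t)(s' \<otimes> t') = ss' \<otimes> tt'\<close>.\<close>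

definition tensor_rels :: "('r, 'k) ring_scheme \<Rightarrow> ('s, 'm) ring_scheme \<Rightarrow> ('t, 'n) ring_scheme \<Rightarrow>
    ('r \<Rightarrow> 's) \<Rightarrow> ('r \<Rightarrow> 't) \<Rightarrow> ('s \<times> 't \<Rightarrow>\<^sub>0 int) set" where
  "tensor_rels R S T \<phi> \<psi> =
     {frag_of (s \<oplus>\<^bsub>S\<^esub> s', t) - frag_of (s, t) - frag_of (s', t) | s s' t.
        s \<in> carrier S \<and> s' \<in> carrier S \<and> t \<in> carrier T} \<union>
     {frag_of (s, t \<oplus>\<^bsub>T\<^esub> t') - frag_of (s, t) - frag_of (s, t') | s t t'.
        s \<in> carrier S \<and> t \<in> carrier T \<and> t' \<in> carrier T} \<union>
     {frag_of (\<phi> r \<otimes>\<^bsub>S\<^esub> s, t) - frag_of (s, \<psi> r \<otimes>\<^bsub>T\<^esub> t) | r s t.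
        r \<in> carrier R \<and> s \<in> carrier S \<and> t \<in> carrier T}"

definition tensor_ideal :: "('r, 'k) ring_scheme \<Rightarrow> ('s, 'm) ring_scheme \<Rightarrow> ('t, 'n) ring_scheme \<Rightarrow>
    ('r \<Rightarrow> 's) \<Rightarrow> ('r \<Rightarrow> 't) \<Rightarrow> ('s \<times> 't \<Rightarrow>\<^sub>0 int) set" where
  "tensor_ideal R S T \<phi> \<psi> =
     generate (free_Abelian_group (carrier S \<times> carrier T)) (tensor_rels R S T \<phi> \<psi>)"

definition tensor_ring :: "('r, 'k) ring_scheme \<Rightarrow> ('s, 'm) ring_scheme \<Rightarrow> ('t, 'n) ring_scheme \<Rightarrow>
    ('r \<Rightarrow> 's) \<Rightarrow> ('r \<Rightarrow> 't) \<Rightarrow> ('s \<times> 't \<Rightarrow>\<^sub>0 int) set ring" where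
  "tensor_ring R S T \<phi> \<psi> = int_monoid_ring (S \<times>\<times> T) Quot tensor_ideal R S T \<phi> \<psi>"

definition pure_tensor :: "('r, 'k) ring_scheme \<Rightarrow> ('s, 'm) ring_scheme \<Rightarrow> ('t, 'n) ring_scheme \<Rightarrow>
    ('r \<Rightarrow> 's) \<Rightarrow> ('r \<Rightarrow> 't) \<Rightarrow> 's \<Rightarrow> 't \<Rightarrow> ('s \<times> 't \<Rightarrow>\<^sub>0 int) set" where
  "pure_tensor R S T \<phi> \<psi> s t = tensor_ideal R S T \<phi> \<psi> +>\<^bsub>int_monoid_ring (S \<times>\<times> T)\<^esub> frag_of (s, t)"

definition frag_eval :: "('u, 'k) ring_scheme \<Rightarrow> ('g \<Rightarrow> 'u) \<Rightarrow> ('g \<Rightarrow>\<^sub>0 int) \<Rightarrow> 'u" where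
  "frag_eval U w c = (\<Oplus>\<^bsub>U\<^esub>g \<in> Poly_Mapping.keys c. [Poly_Mapping.lookup c g] \<cdot>\<^bsub>U\<^esub> w g)"

text \<open>The map out of a tensor product with \<open>s \<otimes> t \<mapsto> u(s)v(t)\<close>: a coset is sent to the common
  value of \<open>\<Sum> n\<^sub>i (s\<^sub>i, t\<^sub>i) \<mapsto> \<Sum> n\<^sub>i u(s\<^sub>i)v(t\<^sub>i)\<close> on its elements.\<close>

definition tensor_map :: "('u, 'k) ring_scheme \<Rightarrow> ('s \<Rightarrow> 'u) \<Rightarrow> ('t \<Rightarrow> 'u) \<Rightarrow>
    ('s \<times> 't \<Rightarrow>\<^sub>0 int) set \<Rightarrow> 'u" where
  "tensor_map U u v X = the_elem (frag_eval U (\<lambda>(s, t). u s \<otimes>\<^bsub>U\<^esub> v t) ` X)"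


section \<open>Algebras over the prime field and the relative Frobenius\<close>

text \<open>The structure map from \<open>\<bbbF>\<^sub>p\<close> is unique on its carrier (lemma \<open>Fp_hom_unique\<close> below), so
  being an \<open>\<bbbF>\<^sub>p\<close>-algebra is a property of a ring, and every ring homomorphism between
  \<open>\<bbbF>\<^sub>p\<close>-algebras is an \<open>\<bbbF>\<^sub>p\<close>-algebra map.  The zero ring is allowed.\<close>

abbreviation Fp :: "nat \<Rightarrow> int ring" where
  "Fp p \<equiv> residue_ring (int p)"

definition Fp_algebra :: "nat \<Rightarrow> ('a, 'm) ring_scheme \<Rightarrow> bool" where
  "Fp_algebra p A \<longleftrightarrow> cring A \<and> (\<exists>\<iota>. \<iota> \<in> ring_hom (Fp p) A)"

text \<open>The copy \<open>A\<^sup>(\<^sup>e\<^sup>)\<close> of \<open>A\<close> is rendered as \<open>A\<close> itself, so that \<open>A\<^sup>(\<^sup>e\<^sup>) \<rightarrow> A\<close>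
  becomes \<open>frob p e A\<close> and \<open>A\<^sup>(\<^sup>e\<^sup>) \<rightarrow> B\<^sup>(\<^sup>e\<^sup>)\<close> becomes \<open>f\<close>;
  \<open>rel_frob_dom p e A B f\<close> is \<open>B\<^sup>(\<^sup>e\<^sup>) \<otimes> A\<close> over \<open>A\<^sup>(\<^sup>e\<^sup>)\<close>.\<close>

definition frob :: "nat \<Rightarrow> nat \<Rightarrow> ('a, 'm) ring_scheme \<Rightarrow> 'a \<Rightarrow> 'a" where
  "frob p e A a = a [^]\<^bsub>A\<^esub> (p ^ e)"

definition rel_frob_dom :: "nat \<Rightarrow> nat \<Rightarrow> ('a, 'm) ring_scheme \<Rightarrow> ('b, 'n) ring_scheme \<Rightarrow>
    ('a \<Rightarrow> 'b) \<Rightarrow> ('b \<times> 'a \<Rightarrow>\<^sub>0 int) set ring" where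
  "rel_frob_dom p e A B f = tensor_ring A B A f (frob p e A)"

definition rel_frob :: "nat \<Rightarrow> nat \<Rightarrow> ('b, 'n) ring_scheme \<Rightarrow> ('a \<Rightarrow> 'b) \<Rightarrow>
    ('b \<times> 'a \<Rightarrow>\<^sub>0 int) set \<Rightarrow> 'b" where
  "rel_frob p e B f = tensor_map B (frob p e B) f"

definition rel_frob_finite :: "nat \<Rightarrow> nat \<Rightarrow> ('a, 'm) ring_scheme \<Rightarrow> ('b, 'n) ring_scheme \<Rightarrow>
    ('a \<Rightarrow> 'b) \<Rightarrow> bool" where
  "rel_frob_finite p e A B f \<longleftrightarrow> finite_ring_map (rel_frob_dom p e A B f) B (rel_frob p e B f)"

definition F_finite :: "nat \<Rightarrow> ('a, 'm) ring_scheme \<Rightarrow> ('b, 'n) ring_scheme \<Rightarrow> ('a \<Rightarrow> 'b) \<Rightarrow> bool" where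
  "F_finite p A B f \<longleftrightarrow> rel_frob_finite p 1 A B f"

definition F_finite_ring :: "nat \<Rightarrow> ('a, 'm) ring_scheme \<Rightarrow> bool" where
  "F_finite_ring p A \<longleftrightarrow> finite_ring_map A A (frob p 1 A)"


section \<open>Basic properties\<close>

lemma module_hom_module:
  assumes "cring R" "cring S" "\<phi> \<in> ring_hom R S"
  shows "module R (hom_module \<phi> S)"
proof -
  interpret R: cring R by fact
  interpret S: cring S by fact
  interpret \<phi>: ring_hom_cring R S \<phi> by unfold_locales (fact assms(3))
  have "abelian_group (hom_module \<phi> S)"
  proof (rule abelian_groupI)
    show "\<exists>y \<in> carrier (hom_module \<phi> S). y \<oplus>\<^bsub>hom_module \<phi> S\<^esub> x = \<zero>\<^bsub>hom_module \<phi> S\<^esub>"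
      if "x \<in> carrier (hom_module \<phi> S)" for x
      using that by (intro bexI[of _ "\<ominus>\<^bsub>S\<^esub> x"]) (auto simp: hom_module_def S.l_neg)
  qed (auto simp: hom_module_def S.a_ac)
  then show ?thesis
    by (intro moduleI assms(1))
       (auto simp: hom_module_def S.l_distr S.r_distr S.m_assoc)
qed

lemma frag_extend_fun_add:
  "frag_extend (\<lambda>g. a g + b g) x = frag_extend a x + frag_extend b x"
  by (simp add: frag_extend_def frag_cmul_distrib2 sum.distrib)

lemma frag_extend_fun_diff:
  "frag_extend (\<lambda>g. a g - b g) x = frag_extend a x - frag_extend b x"
  using frag_extend_fun_add[of "\<lambda>g. a g - b g" b x] by simp

lemma frag_extend_fun_0: "frag_extend (\<lambda>g. 0) x = 0"
  by (simp add: frag_extend_def)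

context
  fixes G :: "('g, 'm) monoid_scheme" and F :: "('g \<Rightarrow>\<^sub>0 int) ring"
  assumes G: "comm_monoid G"
  defines "F \<equiv> int_monoid_ring G"
begin

interpretation G: comm_monoid G by (fact G)

lemma imr_simps:
  "carrier F = {c. Poly_Mapping.keys c \<subseteq> carrier G}"
  "x \<oplus>\<^bsub>F\<^esub> y = x + y" "\<zero>\<^bsub>F\<^esub> = 0" "\<one>\<^bsub>F\<^esub> = frag_of \<one>\<^bsub>G\<^esub>"
  "x \<otimes>\<^bsub>F\<^esub> y = frag_extend (\<lambda>g. frag_extend (\<lambda>h. frag_of (g \<otimes>\<^bsub>G\<^esub> h)) y) x"
  by (auto simp: F_def int_monoid_ring_def free_Abelian_group_def)

lemma imr_add_monoid: "add_monoid F = free_Abelian_group (carrier G)"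
  by (simp add: F_def int_monoid_ring_def free_Abelian_group_def)

lemma imr_mult_diff:
  "x \<otimes>\<^bsub>F\<^esub> (y - z) = x \<otimes>\<^bsub>F\<^esub> y - x \<otimes>\<^bsub>F\<^esub> z" "(y - z) \<otimes>\<^bsub>F\<^esub> x = y \<otimes>\<^bsub>F\<^esub> x - z \<otimes>\<^bsub>F\<^esub> x"
  "x \<otimes>\<^bsub>F\<^esub> (y + z) = x \<otimes>\<^bsub>F\<^esub> y + x \<otimes>\<^bsub>F\<^esub> z" "(y + z) \<otimes>\<^bsub>F\<^esub> x = y \<otimes>\<^bsub>F\<^esub> x + z \<otimes>\<^bsub>F\<^esub> x"
  "0 \<otimes>\<^bsub>F\<^esub> x = 0" "x \<otimes>\<^bsub>F\<^esub> 0 = 0" "frag_of g \<otimes>\<^bsub>F\<^esub> frag_of h = frag_of (g \<otimes>\<^bsub>G\<^esub> h)"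
  by (simp_all add: imr_simps frag_extend_diff frag_extend_fun_diff frag_extend_add
      frag_extend_fun_add frag_extend_fun_0)

lemma imr_closed: "x \<in> carrier F \<Longrightarrow> y \<in> carrier F \<Longrightarrow> x - y \<in> carrier F"
  using keys_diff by (fastforce simp: imr_simps)

lemma imr_keys_diff:
  "Poly_Mapping.keys x \<subseteq> K \<Longrightarrow> Poly_Mapping.keys y \<subseteq> K \<Longrightarrow> Poly_Mapping.keys (x - y) \<subseteq> K"
  using keys_diff by fastforce

lemma imr_mult_closed:
  assumes "x \<in> carrier F" "y \<in> carrier F" shows "x \<otimes>\<^bsub>F\<^esub> y \<in> carrier F"
proof -
  have y: "Poly_Mapping.keys y \<subseteq> carrier G" and x: "Poly_Mapping.keys x \<subseteq> carrier G"
    using assms by (auto simp: imr_simps)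
  from x show ?thesis
  proof (induction x rule: frag_induction)
    case (one g)
    from y show ?case
    proof (induction y rule: frag_induction)
      case (one h)
      then show ?case using \<open>g \<in> carrier G\<close> by (simp add: imr_mult_diff) (simp add: imr_simps)
    qed (simp_all add: imr_mult_diff imr_keys_diff imr_simps(1))
  qed (simp_all add: imr_mult_diff imr_keys_diff imr_simps(1))
qed

lemma imr_comm:
  assumes "x \<in> carrier F" "y \<in> carrier F" shows "x \<otimes>\<^bsub>F\<^esub> y = y \<otimes>\<^bsub>F\<^esub> x"
proof -
  have y: "Poly_Mapping.keys y \<subseteq> carrier G" and x: "Poly_Mapping.keys x \<subseteq> carrier G"
    using assms by (auto simp: imr_simps)
  from x show ?thesis
  proof (induction x rule: frag_induction)
    case (one g)
    from y show ?case
      by (induction y rule: frag_induction)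
        (use \<open>g \<in> carrier G\<close> in \<open>simp_all add: imr_mult_diff G.m_comm\<close>)
  qed (simp_all add: imr_mult_diff)
qed

lemma imr_assoc:
  assumes "x \<in> carrier F" "y \<in> carrier F" "z \<in> carrier F"
  shows "(x \<otimes>\<^bsub>F\<^esub> y) \<otimes>\<^bsub>F\<^esub> z = x \<otimes>\<^bsub>F\<^esub> (y \<otimes>\<^bsub>F\<^esub> z)"
proof -
  have x: "Poly_Mapping.keys x \<subseteq> carrier G" and y: "Poly_Mapping.keys y \<subseteq> carrier G"
    and z: "Poly_Mapping.keys z \<subseteq> carrier G"
    using assms by (auto simp: imr_simps)
  from x show ?thesis
  proof (induction x rule: frag_induction)
    case g: (one g)
    from y show ?case
    proof (induction y rule: frag_induction)
      case h: (one h)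
      from z show ?case
        by (induction z rule: frag_induction)
          (use g h in \<open>simp_all add: imr_mult_diff G.m_assoc\<close>)
    qed (simp_all add: imr_mult_diff)
  qed (simp_all add: imr_mult_diff)
qed

lemma imr_one: "x \<in> carrier F \<Longrightarrow> \<one>\<^bsub>F\<^esub> \<otimes>\<^bsub>F\<^esub> x = x"
proof -
  assume "x \<in> carrier F"
  then have x: "Poly_Mapping.keys x \<subseteq> carrier G"
    by (auto simp: imr_simps)
  from x show ?thesis
    by (induction x rule: frag_induction) (simp_all add: imr_mult_diff imr_simps(4))
qed

lemma cring_imr: "cring F"
proof (rule cringI)
  show "abelian_group F"
    by (rule comm_group_abelian_groupI) (unfold imr_add_monoid, rule abelian_free_Abelian_group)
  show "comm_monoid F"
    by (rule comm_monoidI)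
      (auto intro: imr_mult_closed imr_assoc imr_comm imr_one, auto simp: imr_simps)
qed (simp add: imr_simps(2) imr_mult_diff)

end

lemmas cring_int_monoid_ring = cring_imr

lemma
  fixes U (structure) and w :: "'g \<Rightarrow> 'u" and K :: "'g set"
  assumes "abelian_group U" and w: "w \<in> K \<rightarrow> carrier U"
  shows frag_eval_hom: "frag_eval U w \<in> hom (free_Abelian_group K) (add_monoid U)"
    and frag_eval_frag_of: "g \<in> K \<Longrightarrow> frag_eval U w (frag_of g) = w g"
proof -
  interpret U: abelian_group U by fact
  have cl: "frag_eval U w c \<in> carrier U" if "Poly_Mapping.keys c \<subseteq> K" for c
    unfolding frag_eval_def using that w by (intro U.finsum_closed) (auto intro!: U.add.int_pow_closed)
  have ext: "frag_eval U w c = (\<Oplus>g \<in> L. [Poly_Mapping.lookup c g] \<cdot> w g)"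
    if "finite L" "Poly_Mapping.keys c \<subseteq> L" "L \<subseteq> K" for c L
    unfolding frag_eval_def
    by (rule U.add.finprod_mono_neutral_cong_left)
      (use that w in \<open>auto simp: in_keys_iff add_pow_def intro!: U.add.int_pow_closed[unfolded add_pow_def]\<close>)
  show "frag_eval U w \<in> hom (free_Abelian_group K) (add_monoid U)"
  proof (rule homI)
    fix x y assume "x \<in> carrier (free_Abelian_group K)" "y \<in> carrier (free_Abelian_group K)"
    then have xy: "Poly_Mapping.keys x \<subseteq> K" "Poly_Mapping.keys y \<subseteq> K" by auto
    let ?L = "Poly_Mapping.keys x \<union> Poly_Mapping.keys y"
    have L: "finite ?L" "?L \<subseteq> K" using xy by auto
    have wL: "g \<in> ?L \<Longrightarrow> w g \<in> carrier U" for g using L w by auto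
    have "frag_eval U w (x + y) = (\<Oplus>g \<in> ?L. [Poly_Mapping.lookup (x + y) g] \<cdot> w g)"
      by (rule ext[OF L(1) _ L(2)]) (rule Poly_Mapping.keys_add)
    also have "\<dots> = (\<Oplus>g \<in> ?L. [Poly_Mapping.lookup x g] \<cdot> w g \<oplus> [Poly_Mapping.lookup y g] \<cdot> w g)"
      by (rule U.finsum_cong')
        (auto simp: lookup_add U.add.int_pow_mult wL intro!: U.add.int_pow_closed)
    also have "\<dots> = (\<Oplus>g \<in> ?L. [Poly_Mapping.lookup x g] \<cdot> w g) \<oplus> (\<Oplus>g \<in> ?L. [Poly_Mapping.lookup y g] \<cdot> w g)"
      by (rule U.finsum_addf) (auto simp: wL intro!: U.add.int_pow_closed)
    also have "\<dots> = frag_eval U w x \<oplus> frag_eval U w y"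
      using L by (simp add: ext[of ?L x] ext[of ?L y])
    finally show "frag_eval U w (x \<otimes>\<^bsub>free_Abelian_group K\<^esub> y) =
        frag_eval U w x \<otimes>\<^bsub>add_monoid U\<^esub> frag_eval U w y" by simp
  qed (use cl in auto)
  show "frag_eval U w (frag_of g) = w g" if "g \<in> K"
    using that w by (simp add: ext[of "{g}"] U.add.int_pow_1 Pi_iff)
qed

locale tensor =
  R: cring R + S: cring S + T: cring T for R (structure) and S (structure) and T (structure) +
  fixes \<phi> \<psi>
  assumes \<phi>: "\<phi> \<in> ring_hom R S" and \<psi>: "\<psi> \<in> ring_hom R T"
begin

abbreviation "ZST \<equiv> int_monoid_ring (S \<times>\<times> T)"
abbreviation "J \<equiv> tensor_ideal R S T \<phi> \<psi>"
abbreviation "P \<equiv> tensor_ring R S T \<phi> \<psi>"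
abbreviation pt (infixl "\<otimes>\<^sub>t" 75) where "s \<otimes>\<^sub>t t \<equiv> pure_tensor R S T \<phi> \<psi> s t"

lemma comm_monoid_ST: "comm_monoid (S \<times>\<times> T)"
  by (rule comm_monoidI) (auto simp: DirProd_def S.m_ac T.m_ac)

lemmas Z_simps = imr_simps[OF comm_monoid_ST, simplified]
lemmas Z_mult = imr_mult_diff[OF comm_monoid_ST, simplified]

lemma carrier_ST: "carrier (S \<times>\<times> T) = carrier S \<times> carrier T"
  by (auto simp: DirProd_def)

lemma mult_ST: "(s, t) \<otimes>\<^bsub>S \<times>\<times> T\<^esub> (s', t') = (s \<otimes>\<^bsub>S\<^esub> s', t \<otimes>\<^bsub>T\<^esub> t')"
  by (auto simp: DirProd_def)

sublocale Z: cring ZST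
  by (rule cring_int_monoid_ring[OF comm_monoid_ST])

lemma add_Z: "add_monoid ZST = free_Abelian_group (carrier S \<times> carrier T)"
  using imr_add_monoid[OF comm_monoid_ST] unfolding carrier_ST .

lemma Z_minus: "x \<in> carrier ZST \<Longrightarrow> \<ominus>\<^bsub>ZST\<^esub> x = - x"
  unfolding a_inv_def add_Z by (simp add: Z_simps carrier_ST)

lemma frag_of_Z [simp]: "frag_of (s, t) \<in> carrier ZST \<longleftrightarrow> s \<in> carrier S \<and> t \<in> carrier T"
  by (auto simp: Z_simps carrier_ST)

lemma Z_diff_closed: "x \<in> carrier ZST \<Longrightarrow> y \<in> carrier ZST \<Longrightarrow> x - y \<in> carrier ZST"
  by (rule imr_closed[OF comm_monoid_ST])

lemma \<phi>_closed [simp]: "r \<in> carrier R \<Longrightarrow> \<phi> r \<in> carrier S"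
  and \<psi>_closed [simp]: "r \<in> carrier R \<Longrightarrow> \<psi> r \<in> carrier T"
  using \<phi> \<psi> by (auto dest: ring_hom_closed)

lemma rels_closed: "tensor_rels R S T \<phi> \<psi> \<subseteq> carrier ZST"
  unfolding tensor_rels_def by (auto intro!: Z_diff_closed)

lemma J_generate: "J = generate (add_monoid ZST) (tensor_rels R S T \<phi> \<psi>)"
  unfolding tensor_ideal_def add_Z ..

lemma J_subgroup: "subgroup J (add_monoid ZST)"
  unfolding J_generate by (rule Z.add.generate_is_subgroup) (simp add: rels_closed)

lemma J_diff: "x \<in> J \<Longrightarrow> y \<in> J \<Longrightarrow> x - y \<in> J"
  using subgroup.m_closed[OF J_subgroup, of x "- y"]
    subgroup.m_inv_closed[OF J_subgroup, of y, folded a_inv_def]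
    subgroup.mem_carrier[OF J_subgroup, of y]
  by (simp add: Z_simps(2) Z_minus)

lemma J_zero: "0 \<in> J"
  using subgroup.one_closed[OF J_subgroup] by (simp add: Z_simps)

lemma tensor_relsE:
  assumes "x \<in> tensor_rels R S T \<phi> \<psi>"
  obtains (add_left) s s' t where "s \<in> carrier S" "s' \<in> carrier S" "t \<in> carrier T"
      "x = frag_of (s \<oplus>\<^bsub>S\<^esub> s', t) - frag_of (s, t) - frag_of (s', t)"
  | (add_right) s t t' where "s \<in> carrier S" "t \<in> carrier T" "t' \<in> carrier T"
      "x = frag_of (s, t \<oplus>\<^bsub>T\<^esub> t') - frag_of (s, t) - frag_of (s, t')"
  | (balanced) r s t where "r \<in> carrier R" "s \<in> carrier S" "t \<in> carrier T"
      "x = frag_of (\<phi> r \<otimes>\<^bsub>S\<^esub> s, t) - frag_of (s, \<psi> r \<otimes>\<^bsub>T\<^esub> t)"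
proof -
  from assms show thesis
    unfolding tensor_rels_def
  proof (elim UnE CollectE exE conjE, goal_cases)
    case (1 s s' t) then show ?case by (intro add_left)
  next
    case (2 s t t') then show ?case by (intro add_right)
  next
    case (3 r s t) then show ?case by (intro balanced)
  qed
qed

lemma
  shows tensor_rels_add_left: "s \<in> carrier S \<Longrightarrow> s' \<in> carrier S \<Longrightarrow> t \<in> carrier T \<Longrightarrow>
      frag_of (s \<oplus>\<^bsub>S\<^esub> s', t) - frag_of (s, t) - frag_of (s', t) \<in> tensor_rels R S T \<phi> \<psi>"
    and tensor_rels_add_right: "s \<in> carrier S \<Longrightarrow> t \<in> carrier T \<Longrightarrow> t' \<in> carrier T \<Longrightarrow>
      frag_of (s, t \<oplus>\<^bsub>T\<^esub> t') - frag_of (s, t) - frag_of (s, t') \<in> tensor_rels R S T \<phi> \<psi>"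
    and tensor_rels_balanced: "r \<in> carrier R \<Longrightarrow> s \<in> carrier S \<Longrightarrow> t \<in> carrier T \<Longrightarrow>
      frag_of (\<phi> r \<otimes>\<^bsub>S\<^esub> s, t) - frag_of (s, \<psi> r \<otimes>\<^bsub>T\<^esub> t) \<in> tensor_rels R S T \<phi> \<psi>"
  unfolding tensor_rels_def Un_iff mem_Collect_eq by metis+

lemma rel_mult:
  assumes "s \<in> carrier S" "t \<in> carrier T" "x \<in> tensor_rels R S T \<phi> \<psi>"
  shows "frag_of (s, t) \<otimes>\<^bsub>ZST\<^esub> x \<in> tensor_rels R S T \<phi> \<psi>"
  using assms(3)
proof (cases rule: tensor_relsE)
  case (add_left a b c)
  then show ?thesis
    using assms(1,2) tensor_rels_add_left[of "s \<otimes>\<^bsub>S\<^esub> a" "s \<otimes>\<^bsub>S\<^esub> b" "t \<otimes>\<^bsub>T\<^esub> c"]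
    by (simp add: Z_mult(1,7) mult_ST S.r_distr)
next
  case (add_right a b c)
  then show ?thesis
    using assms(1,2) tensor_rels_add_right[of "s \<otimes>\<^bsub>S\<^esub> a" "t \<otimes>\<^bsub>T\<^esub> b" "t \<otimes>\<^bsub>T\<^esub> c"]
    by (simp add: Z_mult(1,7) mult_ST T.r_distr)
next
  case (balanced a b c)
  then show ?thesis
    using assms(1,2) tensor_rels_balanced[of a "s \<otimes>\<^bsub>S\<^esub> b" "t \<otimes>\<^bsub>T\<^esub> c"]
    by (simp add: Z_mult(1,7) mult_ST S.m_lcomm[of s] T.m_lcomm[of t])
qed

lemma J_mult:
  assumes "x \<in> carrier ZST" "y \<in> J" shows "x \<otimes>\<^bsub>ZST\<^esub> y \<in> J"
proof -
  have x: "Poly_Mapping.keys x \<subseteq> carrier S \<times> carrier T"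
    using assms(1) by (simp add: Z_simps carrier_ST)
  from assms(2)[unfolded J_generate] show ?thesis
  proof (induction y rule: generate.induct)
    case one
    then show ?case by (simp add: Z_simps(3) Z_mult J_zero)
  next
    case (incl h)
    from x show ?case
    proof (induction x rule: frag_induction)
      case (one g)
      then show ?case
        using rel_mult[of "fst g" "snd g" h] incl by (auto simp: J_generate intro: generate.incl)
    qed (auto simp: Z_mult J_zero J_diff)
  next
    case (inv h)
    have *: "h \<in> carrier ZST" using inv rels_closed by auto
    have "x \<otimes>\<^bsub>ZST\<^esub> h \<in> J"
      using x
    proof (induction x rule: frag_induction)
      case (one g)
      then show ?case
        using rel_mult[of "fst g" "snd g" h] inv by (auto simp: J_generate intro: generate.incl)
    qed (auto simp: Z_mult J_zero J_diff)
    then have "0 - x \<otimes>\<^bsub>ZST\<^esub> h \<in> J" by (intro J_diff J_zero)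
    also have "0 - x \<otimes>\<^bsub>ZST\<^esub> h = x \<otimes>\<^bsub>ZST\<^esub> (0 - h)" by (simp only: Z_mult)
    finally show ?case using Z_minus[OF *] by (simp add: a_inv_def)
  next
    case (eng h1 h2)
    then have "x \<otimes>\<^bsub>ZST\<^esub> h1 - (0 - x \<otimes>\<^bsub>ZST\<^esub> h2) \<in> J" by (intro J_diff J_zero)
    then show ?case by (simp add: Z_simps(2) Z_mult)
  qed
qed

sublocale J: ideal J ZST
proof (rule idealI)
  show "ring ZST" by (rule Z.ring_axioms)
  show "subgroup J (add_monoid ZST)" by (rule J_subgroup)
  fix a x assume "a \<in> J" "x \<in> carrier ZST"
  moreover from this have "a \<in> carrier ZST" using subgroup.mem_carrier[OF J_subgroup] by simp
  ultimately show "x \<otimes>\<^bsub>ZST\<^esub> a \<in> J" "a \<otimes>\<^bsub>ZST\<^esub> x \<in> J"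
    using J_mult[of x a] Z.m_comm[of x a] by auto
qed

sublocale P: cring P
  unfolding tensor_ring_def by (rule J.quotient_is_cring) (rule Z.cring_axioms)

lemma quot_hom: "(+>\<^bsub>ZST\<^esub>) J \<in> ring_hom ZST P"
  unfolding tensor_ring_def by (rule J.rcos_ring_hom)

lemma pure_closed [simp]:
  "s \<in> carrier S \<Longrightarrow> t \<in> carrier T \<Longrightarrow> s \<otimes>\<^sub>t t \<in> carrier P"
  unfolding pure_tensor_def by (rule ring_hom_closed[OF quot_hom]) simp

lemma pure_mult:
  assumes "s \<in> carrier S" "t \<in> carrier T" "s' \<in> carrier S" "t' \<in> carrier T"
  shows "(s \<otimes>\<^sub>t t) \<otimes>\<^bsub>P\<^esub> (s' \<otimes>\<^sub>t t') = (s \<otimes>\<^bsub>S\<^esub> s') \<otimes>\<^sub>t (t \<otimes>\<^bsub>T\<^esub> t')"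
  unfolding pure_tensor_def
  by (subst ring_hom_mult[OF quot_hom, symmetric]) (use assms in \<open>simp_all add: Z_mult mult_ST\<close>)

lemma pure_one: "\<one>\<^bsub>P\<^esub> = \<one>\<^bsub>S\<^esub> \<otimes>\<^sub>t \<one>\<^bsub>T\<^esub>"
  unfolding pure_tensor_def ring_hom_one[OF quot_hom, symmetric] by (simp add: Z_simps)

lemma coset_eqI:
  assumes "x \<in> carrier ZST" "y \<in> carrier ZST" "x - y \<in> J"
  shows "J +>\<^bsub>ZST\<^esub> x = J +>\<^bsub>ZST\<^esub> y"
proof -
  have "x \<in> J +>\<^bsub>ZST\<^esub> y"
    unfolding a_r_coset_def r_coset_def using assms(3)
    by (auto simp: Z_simps(2) intro!: bexI[of _ "x - y"])
  then show ?thesis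
    using Z.a_repr_independence[OF _ assms(2) J_subgroup] by auto
qed

lemma pure_add_left:
  assumes "s \<in> carrier S" "s' \<in> carrier S" "t \<in> carrier T"
  shows "(s \<oplus>\<^bsub>S\<^esub> s') \<otimes>\<^sub>t t = s \<otimes>\<^sub>t t \<oplus>\<^bsub>P\<^esub> s' \<otimes>\<^sub>t t"
proof -
  have "frag_of (s \<oplus>\<^bsub>S\<^esub> s', t) - (frag_of (s, t) \<oplus>\<^bsub>ZST\<^esub> frag_of (s', t)) \<in> J"
    unfolding J_generate
    by (rule generate.incl, unfold Z_simps(2) diff_diff_eq[symmetric], rule tensor_rels_add_left)
      (use assms in simp_all)
  then show ?thesis
    unfolding pure_tensor_def using assms
    by (subst ring_hom_add[OF quot_hom, symmetric]) (simp, simp, intro coset_eqI, simp_all)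
qed

lemma pure_add_right:
  assumes "s \<in> carrier S" "t \<in> carrier T" "t' \<in> carrier T"
  shows "s \<otimes>\<^sub>t (t \<oplus>\<^bsub>T\<^esub> t') = s \<otimes>\<^sub>t t \<oplus>\<^bsub>P\<^esub> s \<otimes>\<^sub>t t'"
proof -
  have "frag_of (s, t \<oplus>\<^bsub>T\<^esub> t') - (frag_of (s, t) \<oplus>\<^bsub>ZST\<^esub> frag_of (s, t')) \<in> J"
    unfolding J_generate
    by (rule generate.incl, unfold Z_simps(2) diff_diff_eq[symmetric], rule tensor_rels_add_right)
      (use assms in simp_all)
  then show ?thesis
    unfolding pure_tensor_def using assms
    by (subst ring_hom_add[OF quot_hom, symmetric]) (simp, simp, intro coset_eqI, simp_all)
qed

lemma pure_balanced:
  assumes "r \<in> carrier R" "s \<in> carrier S" "t \<in> carrier T"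
  shows "(\<phi> r \<otimes>\<^bsub>S\<^esub> s) \<otimes>\<^sub>t t = s \<otimes>\<^sub>t (\<psi> r \<otimes>\<^bsub>T\<^esub> t)"
proof -
  have "frag_of (\<phi> r \<otimes>\<^bsub>S\<^esub> s, t) - frag_of (s, \<psi> r \<otimes>\<^bsub>T\<^esub> t) \<in> J"
    unfolding J_generate
    by (rule generate.incl, rule tensor_rels_balanced) (use assms in simp_all)
  then show ?thesis
    unfolding pure_tensor_def using assms by (intro coset_eqI) simp_all
qed

lemma in_left_hom: "(\<lambda>s. s \<otimes>\<^sub>t \<one>\<^bsub>T\<^esub>) \<in> ring_hom S P"
  by (rule ring_hom_memI) (auto simp: pure_mult pure_add_left pure_one)

lemma in_right_hom: "(\<lambda>t. \<one>\<^bsub>S\<^esub> \<otimes>\<^sub>t t) \<in> ring_hom T P"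
  by (rule ring_hom_memI) (auto simp: pure_mult pure_add_right pure_one)

lemma carrier_P: "carrier P = (+>\<^bsub>ZST\<^esub>) J ` carrier ZST"
  by (auto simp: tensor_ring_def FactRing_def A_RCOSETS_def' a_r_coset_def')

lemma P_induct [consumes 1, case_names pure diff]:
  assumes "X \<in> carrier P"
    and pure: "\<And>s t. s \<in> carrier S \<Longrightarrow> t \<in> carrier T \<Longrightarrow> Q (s \<otimes>\<^sub>t t)"
    and diff: "\<And>X Y. X \<in> carrier P \<Longrightarrow> Y \<in> carrier P \<Longrightarrow> Q X \<Longrightarrow> Q Y \<Longrightarrow> Q (X \<ominus>\<^bsub>P\<^esub> Y)"
  shows "Q X"
proof -
  have hom: "ring_hom_cring ZST P ((+>\<^bsub>ZST\<^esub>) J)"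
    by unfold_locales (rule quot_hom)
  obtain c where c: "c \<in> carrier ZST" "X = J +>\<^bsub>ZST\<^esub> c"
    using assms(1) by (auto simp: carrier_P)
  have k: "Poly_Mapping.keys c \<subseteq> carrier S \<times> carrier T"
    using c by (simp add: Z_simps carrier_ST)
  have "c \<in> carrier ZST \<and> Q (J +>\<^bsub>ZST\<^esub> c)"
    using k
  proof (induction c rule: frag_induction)
    case zero
    let ?z = "\<one>\<^bsub>S\<^esub> \<otimes>\<^sub>t \<one>\<^bsub>T\<^esub>"
    have "Q (?z \<ominus>\<^bsub>P\<^esub> ?z)" by (intro diff pure) auto
    moreover have "?z \<ominus>\<^bsub>P\<^esub> ?z = \<zero>\<^bsub>P\<^esub>"
      using P.r_neg[OF pure_closed[OF S.one_closed T.one_closed]] by (simp add: a_minus_def)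
    ultimately have "Q \<zero>\<^bsub>P\<^esub>" by simp
    also have "\<zero>\<^bsub>P\<^esub> = J +>\<^bsub>ZST\<^esub> 0"
      using ring_hom_cring.hom_zero[OF hom] by (simp add: Z_simps)
    finally show ?case by (simp add: Z_simps)
  next
    case (one g)
    then show ?case using pure[of "fst g" "snd g"]
      by (cases g) (auto simp: pure_tensor_def)
  next
    case (diff a b)
    then have ab: "a \<in> carrier ZST" "b \<in> carrier ZST" by auto
    have "a - b = a \<ominus>\<^bsub>ZST\<^esub> b" using ab by (simp add: a_minus_def Z_minus Z_simps)
    then have "J +>\<^bsub>ZST\<^esub> (a - b) = (J +>\<^bsub>ZST\<^esub> a) \<ominus>\<^bsub>P\<^esub> (J +>\<^bsub>ZST\<^esub> b)"
      using ab ring_hom_add[OF quot_hom, of a "\<ominus>\<^bsub>ZST\<^esub> b"] ring_hom_cring.hom_a_inv[OF hom ab(2)]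
      by (simp add: a_minus_def)
    then show ?case
      using diff ab assms(3)[of "J +>\<^bsub>ZST\<^esub> a" "J +>\<^bsub>ZST\<^esub> b"] by (auto simp: carrier_P Z_diff_closed)
  qed
  then show ?thesis using c by simp
qed

context
  fixes U (structure) and u v
  assumes U: "cring U" and u: "u \<in> ring_hom S U" and v: "v \<in> ring_hom T U"
    and uv: "\<And>r. r \<in> carrier R \<Longrightarrow> u (\<phi> r) = v (\<psi> r)"
begin

interpretation U: cring U by (fact U)
interpretation u: ring_hom_cring S U u by unfold_locales (fact u)
interpretation v: ring_hom_cring T U v by unfold_locales (fact v)

abbreviation (input) "w \<equiv> \<lambda>(s, t). u s \<otimes>\<^bsub>U\<^esub> v t"

lemma w_closed: "w \<in> carrier S \<times> carrier T \<rightarrow> carrier U"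
  by auto

interpretation ev: group_hom "add_monoid ZST" "add_monoid U" "frag_eval U w"
  unfolding group_hom_def group_hom_axioms_def
  using frag_eval_hom[OF U.abelian_group_axioms w_closed] Z.add.is_group U.add.is_group
  unfolding add_Z by blast

lemma ev_of: "s \<in> carrier S \<Longrightarrow> t \<in> carrier T \<Longrightarrow> frag_eval U w (frag_of (s, t)) = u s \<otimes>\<^bsub>U\<^esub> v t"
  using frag_eval_frag_of[OF U.abelian_group_axioms w_closed, of "(s, t)"] by simp

lemma ev_add: "x \<in> carrier ZST \<Longrightarrow> y \<in> carrier ZST \<Longrightarrow>
    frag_eval U w (x + y) = frag_eval U w x \<oplus>\<^bsub>U\<^esub> frag_eval U w y"
  using ev.hom_mult[of x y] by (simp add: Z_simps(2))

lemma ev_closed: "x \<in> carrier ZST \<Longrightarrow> frag_eval U w x \<in> carrier U"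
  using ev.hom_closed[of x] by simp

lemma ev_diff:
  assumes "x \<in> carrier ZST" "y \<in> carrier ZST"
  shows "frag_eval U w (x - y) = frag_eval U w x \<ominus>\<^bsub>U\<^esub> frag_eval U w y"
proof -
  have "frag_eval U w x = frag_eval U w (x - y) \<oplus>\<^bsub>U\<^esub> frag_eval U w y"
    using ev_add[of "x - y" y] assms by (simp add: Z_diff_closed)
  then show ?thesis
    using assms ev_closed[of y] ev_closed[OF Z_diff_closed[OF assms]]
    by (simp add: a_minus_def U.a_assoc U.r_neg)
qed

lemma ev_rels: 
  assumes "x \<in> tensor_rels R S T \<phi> \<psi>"
  shows "frag_eval U w x = \<zero>\<^bsub>U\<^esub>"
  using assms
proof (cases rule: tensor_relsE)
  case (add_left a b c)
  then have "frag_eval U w x = ((u a \<oplus>\<^bsub>U\<^esub> u b) \<otimes>\<^bsub>U\<^esub> v c) \<ominus>\<^bsub>U\<^esub> (u a \<otimes>\<^bsub>U\<^esub> v c) \<ominus>\<^bsub>U\<^esub> (u b \<otimes>\<^bsub>U\<^esub> v c)"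
    by (simp add: ev_diff ev_of Z_diff_closed)
  moreover have "u a \<in> carrier U" "u b \<in> carrier U" "v c \<in> carrier U" using add_left by auto
  ultimately show ?thesis by algebra
next
  case (add_right a b c)
  then have "frag_eval U w x = (u a \<otimes>\<^bsub>U\<^esub> (v b \<oplus>\<^bsub>U\<^esub> v c)) \<ominus>\<^bsub>U\<^esub> (u a \<otimes>\<^bsub>U\<^esub> v b) \<ominus>\<^bsub>U\<^esub> (u a \<otimes>\<^bsub>U\<^esub> v c)"
    by (simp add: ev_diff ev_of Z_diff_closed)
  moreover have "u a \<in> carrier U" "v b \<in> carrier U" "v c \<in> carrier U" using add_right by auto
  ultimately show ?thesis by algebra
next
  case (balanced a b c)
  then have "frag_eval U w x = ((v (\<psi> a) \<otimes>\<^bsub>U\<^esub> u b) \<otimes>\<^bsub>U\<^esub> v c) \<ominus>\<^bsub>U\<^esub> (u b \<otimes>\<^bsub>U\<^esub> (v (\<psi> a) \<otimes>\<^bsub>U\<^esub> v c))"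
    by (simp add: ev_diff ev_of Z_diff_closed uv)
  moreover have "v (\<psi> a) \<in> carrier U" "u b \<in> carrier U" "v c \<in> carrier U" using balanced by auto
  ultimately show ?thesis by algebra
qed

lemma ev_J: "x \<in> J \<Longrightarrow> frag_eval U w x = \<zero>\<^bsub>U\<^esub>"
proof -
  have "tensor_rels R S T \<phi> \<psi> \<subseteq> kernel (add_monoid ZST) (add_monoid U) (frag_eval U w)"
    using rels_closed ev_rels by (auto simp: kernel_def)
  then have "J \<subseteq> kernel (add_monoid ZST) (add_monoid U) (frag_eval U w)"
    unfolding J_generate by (rule Z.add.generate_subgroup_incl) (rule ev.subgroup_kernel)
  then show "x \<in> J \<Longrightarrow> frag_eval U w x = \<zero>\<^bsub>U\<^esub>" by (auto simp: kernel_def)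
qed

lemma tensor_map_coset:
  assumes "c \<in> carrier ZST"
  shows "tensor_map U u v (J +>\<^bsub>ZST\<^esub> c) = frag_eval U w c"
proof -
  have "frag_eval U w ` (J +>\<^bsub>ZST\<^esub> c) = {frag_eval U w c}"
  proof (rule equalityI)
    show "frag_eval U w ` (J +>\<^bsub>ZST\<^esub> c) \<subseteq> {frag_eval U w c}"
      using assms ev_closed[OF assms]
      by (auto simp: a_r_coset_def r_coset_def Z_simps(2) ev_add[OF J.a_Hcarr] ev_J)
    show "{frag_eval U w c} \<subseteq> frag_eval U w ` (J +>\<^bsub>ZST\<^esub> c)"
      using J.a_rcos_self[OF assms] by auto
  qed
  then show ?thesis by (simp add: tensor_map_def)
qed

lemma tensor_map_pure:
  assumes "s \<in> carrier S" "t \<in> carrier T"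
  shows "tensor_map U u v (s \<otimes>\<^sub>t t) = u s \<otimes>\<^bsub>U\<^esub> v t"
  unfolding pure_tensor_def using assms by (simp add: tensor_map_coset ev_of)

lemma ev_mult:
  assumes "x \<in> carrier ZST" "y \<in> carrier ZST"
  shows "frag_eval U w (x \<otimes>\<^bsub>ZST\<^esub> y) = frag_eval U w x \<otimes>\<^bsub>U\<^esub> frag_eval U w y"
proof -
  have x: "Poly_Mapping.keys x \<subseteq> carrier S \<times> carrier T"
    and y: "Poly_Mapping.keys y \<subseteq> carrier S \<times> carrier T"
    using assms by (simp_all add: Z_simps carrier_ST)
  have z: "0 \<in> carrier ZST" "frag_eval U w 0 = \<zero>\<^bsub>U\<^esub>"
    using Z.zero_closed ev_J[OF J_zero] by (auto simp: Z_simps)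
  have "x \<in> carrier ZST \<and> frag_eval U w (x \<otimes>\<^bsub>ZST\<^esub> y) = frag_eval U w x \<otimes>\<^bsub>U\<^esub> frag_eval U w y"
    using x
  proof (induction x rule: frag_induction)
    case zero
    then show ?case using z ev_closed[OF assms(2)] by (simp add: Z_mult)
  next
    case (one g)
    then obtain s t where g: "g = (s, t)" "s \<in> carrier S" "t \<in> carrier T" by auto
    have "y \<in> carrier ZST \<and> frag_eval U w (frag_of g \<otimes>\<^bsub>ZST\<^esub> y) = frag_eval U w (frag_of g) \<otimes>\<^bsub>U\<^esub> frag_eval U w y"
      using y
    proof (induction y rule: frag_induction)
      case zero
      then show ?case using z g by (simp add: Z_mult ev_of)
    next
      case (one h)
      then obtain s' t' where h: "h = (s', t')" "s' \<in> carrier S" "t' \<in> carrier T" by auto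
      then show ?case using g by (simp add: Z_mult mult_ST ev_of U.m_ac)
    next
      case (diff a b)
      have "frag_of g \<in> carrier ZST" using g by simp
      with diff show ?case
        using ev_closed[of a] ev_closed[of b] ev_closed[of "frag_of g"]
        by (simp add: Z_mult ev_diff Z_diff_closed a_minus_def U.r_distr U.r_minus)
    qed
    then show ?case using g by simp
  next
    case (diff a b)
    then show ?case
      using ev_closed[of a] ev_closed[of b] ev_closed[of y] assms(2)
      by (simp add: Z_mult ev_diff Z_diff_closed a_minus_def U.l_distr U.l_minus)
  qed
  then show ?thesis by simp
qed

lemma tensor_map_hom: "tensor_map U u v \<in> ring_hom P U"
proof (rule ring_hom_memI)
  show "tensor_map U u v X \<in> carrier U" if "X \<in> carrier P" for X
    using that by (auto simp: carrier_P tensor_map_coset ev_closed)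
  show "tensor_map U u v \<one>\<^bsub>P\<^esub> = \<one>\<^bsub>U\<^esub>"
    by (simp add: pure_one tensor_map_pure)
  fix X Y assume "X \<in> carrier P" "Y \<in> carrier P"
  then obtain x y where xy: "x \<in> carrier ZST" "X = J +>\<^bsub>ZST\<^esub> x" "y \<in> carrier ZST" "Y = J +>\<^bsub>ZST\<^esub> y"
    by (auto simp: carrier_P)
  then show "tensor_map U u v (X \<otimes>\<^bsub>P\<^esub> Y) = tensor_map U u v X \<otimes>\<^bsub>U\<^esub> tensor_map U u v Y"
    by (simp add: ring_hom_mult[OF quot_hom, symmetric] tensor_map_coset ev_mult)
  from xy show "tensor_map U u v (X \<oplus>\<^bsub>P\<^esub> Y) = tensor_map U u v X \<oplus>\<^bsub>U\<^esub> tensor_map U u v Y"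
    using Z.add.m_closed[of x y]
    by (simp add: ring_hom_add[OF quot_hom, symmetric] tensor_map_coset ev_add[folded Z_simps(2)])
qed

lemma tensor_map_unique:
  assumes k: "k \<in> ring_hom P U"
    and "\<And>s t. s \<in> carrier S \<Longrightarrow> t \<in> carrier T \<Longrightarrow> k (s \<otimes>\<^sub>t t) = u s \<otimes>\<^bsub>U\<^esub> v t"
    and "X \<in> carrier P"
  shows "k X = tensor_map U u v X"
proof -
  interpret k: ring_hom_cring P U k by unfold_locales (fact k)
  interpret m: ring_hom_cring P U "tensor_map U u v" by unfold_locales (rule tensor_map_hom)
  from assms(3) show ?thesis
    by (induction X rule: P_induct) (simp_all add: assms(2) tensor_map_pure a_minus_def)
qed

end

end

lemma Fp_hom_char:
  assumes "prime p" "cring A" "\<iota> \<in> ring_hom (Fp p) A"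
  shows "[p] \<cdot>\<^bsub>A\<^esub> \<one>\<^bsub>A\<^esub> = \<zero>\<^bsub>A\<^esub>"
    and "n < p \<Longrightarrow> \<iota> (int n) = [n] \<cdot>\<^bsub>A\<^esub> \<one>\<^bsub>A\<^esub>"
proof -
  interpret A: cring A by fact
  interpret K: residues "int p" "Fp p"
    using prime_gt_1_nat[OF assms(1)] by (auto simp: residues_def)
  interpret \<iota>: ring_hom_cring "Fp p" A \<iota>
    by unfold_locales (fact assms(3))
  have p: "p > 1" by (rule prime_gt_1_nat) fact
  have *: "\<iota> (int n mod int p) = [n] \<cdot>\<^bsub>A\<^esub> \<one>\<^bsub>A\<^esub>" for n
  proof (induction n)
    case 0
    have "\<iota> \<zero>\<^bsub>Fp p\<^esub> = \<zero>\<^bsub>A\<^esub>" by (rule \<iota>.hom_zero)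
    then show ?case by (simp add: K.res_zero_eq)
  next
    case (Suc n)
    have "int (Suc n) mod int p = (int n mod int p) \<oplus>\<^bsub>Fp p\<^esub> \<one>\<^bsub>Fp p\<^esub>"
      by (simp add: K.res_add_eq K.res_one_eq mod_simps add.commute)
    moreover have "int n mod int p \<in> carrier (Fp p)"
      using p by (simp add: K.res_carrier_eq)
    ultimately show ?case using Suc by simp
  qed
  show "[p] \<cdot>\<^bsub>A\<^esub> \<one>\<^bsub>A\<^esub> = \<zero>\<^bsub>A\<^esub>" using *[of p] *[of 0] by simp
  show "\<iota> (int n) = [n] \<cdot>\<^bsub>A\<^esub> \<one>\<^bsub>A\<^esub>" if "n < p" using *[of n] that by simp
qed

lemma Fp_hom_unique:
  assumes "prime p" "cring A" "\<iota> \<in> ring_hom (Fp p) A" "\<iota>' \<in> ring_hom (Fp p) A"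
    and "x \<in> carrier (Fp p)"
  shows "\<iota> x = \<iota>' x"
proof -
  have "x = int (nat x)" "nat x < p" using assms(5) by (auto simp: residue_ring_def)
  then show ?thesis using Fp_hom_char(2)[OF assms(1-3)] Fp_hom_char(2)[OF assms(1,2,4)] by metis
qed

lemma Fp_algebra_hom:
  assumes "Fp_algebra p A" "cring B" "f \<in> ring_hom A B"
  shows "Fp_algebra p B"
  using assms unfolding Fp_algebra_def by (meson ring_hom_trans)

lemma frob_char:
  fixes A (structure)
  assumes p: "prime p" and A: "Fp_algebra p A"
  shows "frob p e A \<in> ring_hom A A"
proof -
  interpret cring A using A by (simp add: Fp_algebra_def)
  have char: "[p] \<cdot> \<one> = \<zero>"
    using A Fp_hom_char(1)[OF p cring_axioms] by (auto simp: Fp_algebra_def)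
  have kill: "[n] \<cdot> a = \<zero>" if dvd: "p dvd n" and a: "a \<in> carrier A" for n :: nat and a
  proof -
    obtain k where n: "n = p * k" using dvd by (rule dvdE)
    have "[n] \<cdot> a = [k] \<cdot> ([p] \<cdot> a)"
      using a by (simp add: n add.nat_pow_pow)
    also have "[p] \<cdot> a = ([p] \<cdot> \<one>) \<otimes> a"
      using a add_pow_ldistr[of \<one> a p] by simp
    finally show ?thesis using a by (simp add: char)
  qed
  have binom: "(a \<oplus> b) [^] n = (\<Oplus>i\<in>{..n}. [(n choose i)] \<cdot> (a [^] i \<otimes> b [^] (n - i)))"
    if ab: "a \<in> carrier A" "b \<in> carrier A" for a b and n :: nat
  proof (induction n)
    case 0
    then show ?case by simp
  next
    case (Suc n)
    let ?g = "\<lambda>i. a [^] i \<otimes> b [^] (Suc n - i)"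
    have g: "?g i \<in> carrier A" for i using ab by simp
    have "(a \<oplus> b) [^] Suc n = (\<Oplus>i\<in>{..n}. [(n choose i)] \<cdot> (a [^] i \<otimes> b [^] (n - i))) \<otimes> a
        \<oplus> (\<Oplus>i\<in>{..n}. [(n choose i)] \<cdot> (a [^] i \<otimes> b [^] (n - i))) \<otimes> b"
      using ab by (simp add: Suc r_distr)
    also have "(\<Oplus>i\<in>{..n}. [(n choose i)] \<cdot> (a [^] i \<otimes> b [^] (n - i))) \<otimes> a
        = (\<Oplus>i\<in>{..n}. [(n choose i)] \<cdot> ?g (Suc i))"
    proof (subst finsum_ldistr)
      show "(\<Oplus>i\<in>{..n}. [(n choose i)] \<cdot> (a [^] i \<otimes> b [^] (n - i)) \<otimes> a) = (\<Oplus>i\<in>{..n}. [(n choose i)] \<cdot> ?g (Suc i))"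
      proof (rule finsum_cong')
        fix i
        have "a [^] i \<otimes> b [^] (n - i) \<otimes> a = ?g (Suc i)" using ab by (simp add: m_ac)
        then show "[(n choose i)] \<cdot> (a [^] i \<otimes> b [^] (n - i)) \<otimes> a = [(n choose i)] \<cdot> ?g (Suc i)"
          using ab by (simp add: add_pow_ldistr)
      qed (use ab in auto)
    qed (use ab in auto)
    also have "\<dots> = (\<Oplus>i\<in>{..n}. [(n choose i)] \<cdot> ?g (Suc i)) \<oplus> [(0::nat)] \<cdot> ?g 0"
      using ab by (simp add: Pi_iff)
    also have "\<dots> = (\<Oplus>i\<in>{..Suc n}. [(if i = 0 then 0 else n choose (i - 1))] \<cdot> ?g i)"
      using ab by (subst finsum_Suc2) (auto simp: Pi_iff)
    also have "(\<Oplus>i\<in>{..n}. [(n choose i)] \<cdot> (a [^] i \<otimes> b [^] (n - i))) \<otimes> b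
        = (\<Oplus>i\<in>{..n}. [(n choose i)] \<cdot> ?g i)"
    proof (subst finsum_ldistr)
      show "(\<Oplus>i\<in>{..n}. [(n choose i)] \<cdot> (a [^] i \<otimes> b [^] (n - i)) \<otimes> b) = (\<Oplus>i\<in>{..n}. [(n choose i)] \<cdot> ?g i)"
      proof (rule finsum_cong')
        fix i assume "i \<in> {..n}"
        then have "a [^] i \<otimes> b [^] (n - i) \<otimes> b = ?g i" using ab by (simp add: m_ac Suc_diff_le)
        then show "[(n choose i)] \<cdot> (a [^] i \<otimes> b [^] (n - i)) \<otimes> b = [(n choose i)] \<cdot> ?g i"
          using ab by (simp add: add_pow_ldistr)
      qed (use ab in auto)
    qed (use ab in auto)
    also have "\<dots> = (\<Oplus>i\<in>{..Suc n}. [(n choose i)] \<cdot> ?g i)"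
      using ab by (subst finsum_Suc) (auto simp: Pi_iff binomial_eq_0)
    also have "(\<Oplus>i\<in>{..Suc n}. [(if i = 0 then 0 else n choose (i - 1))] \<cdot> ?g i) \<oplus> (\<Oplus>i\<in>{..Suc n}. [(n choose i)] \<cdot> ?g i)
       = (\<Oplus>i\<in>{..Suc n}. [(if i = 0 then 0 else n choose (i - 1))] \<cdot> ?g i \<oplus> [(n choose i)] \<cdot> ?g i)"
      using g by (intro finsum_addf[symmetric]) auto
    also have "\<dots> = (\<Oplus>i\<in>{..Suc n}. [(Suc n choose i)] \<cdot> ?g i)"
    proof (rule finsum_cong')
      fix i
      show "[(if i = 0 then 0 else n choose (i - 1))] \<cdot> ?g i \<oplus> [(n choose i)] \<cdot> ?g i = [(Suc n choose i)] \<cdot> ?g i"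
        using add.nat_pow_mult[OF g[of i], of "n choose (i - 1)" "n choose i"] g[of i]
        by (cases i) (simp_all del: nat_pow_Suc)
    qed (use g in auto)
    finally show ?case .
  qed
  have add1: "(a \<oplus> b) [^] p = a [^] p \<oplus> b [^] p" if ab: "a \<in> carrier A" "b \<in> carrier A" for a b
  proof -
    let ?h = "\<lambda>i. [(p choose i)] \<cdot> (a [^] i \<otimes> b [^] (p - i))"
    have p0: "0 < p" using p by (rule prime_gt_0_nat)
    have "(a \<oplus> b) [^] p = (\<Oplus>i\<in>{..p}. ?h i)" by (rule binom[OF ab])
    also have "\<dots> = (\<Oplus>i\<in>{0, p}. ?h i)"
    proof (rule add.finprod_mono_neutral_cong_right)
      show "?h i = \<zero>" if "i \<in> {..p} - {0, p}" for i
        using that ab p by (auto intro!: kill dvd_choose_prime)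
    qed (use ab in auto)
    also have "\<dots> = a [^] p \<oplus> b [^] p"
      using ab p0 by (simp add: a_comm)
    finally show ?thesis .
  qed
  have "(a \<oplus> b) [^] (p ^ e) = a [^] (p ^ e) \<oplus> b [^] (p ^ e)"
    if ab: "a \<in> carrier A" "b \<in> carrier A" for a b
  proof (induction e)
    case 0
    then show ?case using ab by simp
  next
    case (Suc e)
    have "x [^] (p ^ Suc e) = (x [^] (p ^ e)) [^] p" if "x \<in> carrier A" for x
      using that by (simp add: nat_pow_pow mult.commute)
    then show ?case using Suc ab by (simp add: add1 del: power_Suc)
  qed
  then show ?thesis
    by (intro ring_hom_memI) (auto simp: frob_def nat_pow_distrib)
qed

locale Fp_algebra_map =
  fixes p :: nat and A (structure) and B (structure) and f
  assumes p: "prime p" and A: "Fp_algebra p A" and B: "Fp_algebra p B" and f: "f \<in> ring_hom A B"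
begin

lemma tensor_rel_frob: "tensor A B A f (frob p e A)"
  using A B f frob_char[OF p A] by (auto simp: tensor_def tensor_axioms_def Fp_algebra_def)

lemma
  shows rel_frob_hom: "rel_frob p e B f \<in> ring_hom (rel_frob_dom p e A B f) B"
    and rel_frob_pure: "b \<in> carrier B \<Longrightarrow> a \<in> carrier A \<Longrightarrow>
      rel_frob p e B f (pure_tensor A B A f (frob p e A) b a) = b [^]\<^bsub>B\<^esub> (p ^ e) \<otimes>\<^bsub>B\<^esub> f a"
proof -
  interpret tensor A B A f "frob p e A" by (rule tensor_rel_frob)
  have f': "ring_hom_ring A B f" by (intro ring_hom_ringI2 R.ring_axioms S.ring_axioms f)
  have c: "frob p e B (f r) = f (frob p e A r)" if "r \<in> carrier A" for r
    using that by (simp add: frob_def ring_hom_ring.hom_nat_pow[OF f'])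
  note hyps = S.cring_axioms frob_char[OF p B, of e] f c
  show "rel_frob p e B f \<in> ring_hom (rel_frob_dom p e A B f) B"
    unfolding rel_frob_def rel_frob_dom_def by (rule tensor_map_hom[OF hyps])
  show "b \<in> carrier B \<Longrightarrow> a \<in> carrier A \<Longrightarrow>
      rel_frob p e B f (pure_tensor A B A f (frob p e A) b a) = b [^]\<^bsub>B\<^esub> (p ^ e) \<otimes>\<^bsub>B\<^esub> f a"
    unfolding rel_frob_def by (simp add: tensor_map_pure[OF hyps] frob_def)
qed

end

end

theory Submission
  imports Defs
begin

text \<open>
  Finiteness of a ring map \<open>R \<rightarrow> S\<close> depends only on its image in \<open>S\<close>, and even less is needed:
  if \<open>K \<subseteq> S\<close> is any set whose additive span is the image, then the map is finite iff some finite
  \<open>X\<close> makes the products \<open>k x\<close> with \<open>k \<in> K\<close>, \<open>x \<in> X\<close> span \<open>S\<close> additively.  The image of the relative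
  Frobenius \<open>\<Phi>\<^sub>e(A, B)\<close> is spanned by the elements \<open>b\<^sup>q f(a)\<close> with \<open>q = p\<^sup>e\<close>, so the tensor product
  disappears (lemma \<open>rel_frob_finite_iff\<close>): \<open>\<Phi>\<^sub>e(A, B)\<close> is finite iff \<open>B\<close> is the additive span of
  \<open>B\<^sup>q f(A) X\<close> for some finite \<open>X\<close>.

  Apart from base change, the claims then come from one transitivity principle, \<open>finite_over_trans\<close>: if \<open>K X\<close>
  spans \<open>S\<close> and every element of \<open>K\<close> lies in the span of \<open>L Y\<close>, with \<open>X\<close> and \<open>Y\<close> finite, then
  \<open>L Y X\<close> spans \<open>S\<close>.

  \<^item> If \<open>B\<close> is spanned by \<open>B\<^sup>q f(A) X\<close>, then, since Frobenius is additive, \<open>B\<^sup>p\<close> is spanned by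
    \<open>p\<close>-th powers of such products, which lie in \<open>B\<^sup>r f(A) X\<^sup>p\<close> with \<open>r = pq\<close>.  So if \<open>\<Phi>\<^sub>1\<close> is finite,
    \<open>e\<close> can be raised by one.  It can be lowered to \<open>1\<close> because \<open>B\<^sup>q \<subseteq> B\<^sup>p\<close> for \<open>e > 0\<close>.
  \<^item> For \<open>A \<rightarrow> B \<rightarrow> C\<close> with \<open>B\<close> spanned by \<open>B\<^sup>p f(A) X\<close>, every \<open>c\<^sup>p g(b)\<close> is in the span of
    \<open>(c g(B))\<^sup>p g(f(A)) g(X)\<close>, which gives the composition claim.  Cancellation on the left holds since
    \<open>g(f(A)) \<subseteq> g(B)\<close>.
  \<^item> The image of \<open>\<bbbF>\<^sub>p\<close> in \<open>A\<close> is fixed by Frobenius, so \<open>A\<^sup>p \<bbbF>\<^sub>p = A\<^sup>p\<close>: a ring is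
    \<open>F\<close>-finite iff it is so over \<open>\<bbbF>\<^sub>p\<close>.  The last two claims are then cancellation and composition
    for \<open>\<bbbF>\<^sub>p \<rightarrow> A \<rightarrow> B\<close>.
  \<^item> For base change \<open>A' \<otimes>\<^sub>A B\<close>, the elements \<open>1 \<otimes> x\<close> with \<open>x \<in> X\<close> still generate, because
    \<open>s \<otimes> b\<^sup>p f(a) x = (1 \<otimes> b)\<^sup>p (h(a)s \<otimes> 1) (1 \<otimes> x)\<close>.
\<close>

section \<open>Additive spans and finiteness over a subset\<close>

definition add_span :: "('a, 'm) ring_scheme \<Rightarrow> 'a set \<Rightarrow> 'a set" where
  "add_span S G = generate (add_monoid S) G"

text \<open>When \<open>K\<close> is a subring this says that \<open>S\<close> is a finitely generated \<open>K\<close>-module.  It is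
  phrased for an arbitrary subset so that \<open>K\<close> may be replaced by generators of a subring.\<close>

definition finite_over :: "('a, 'm) ring_scheme \<Rightarrow> 'a set \<Rightarrow> bool" where
  "finite_over S K \<longleftrightarrow>
     (\<exists>X. finite X \<and> X \<subseteq> carrier S \<and> carrier S \<subseteq> add_span S (K <#>\<^bsub>S\<^esub> X))"

lemma set_mult_memI: "k \<in> K \<Longrightarrow> l \<in> L \<Longrightarrow> k \<otimes>\<^bsub>S\<^esub> l \<in> K <#>\<^bsub>S\<^esub> L"
  by (auto simp: set_mult_def)

lemma set_mult_memE:
  assumes "z \<in> K <#>\<^bsub>S\<^esub> L"
  obtains k l where "k \<in> K" "l \<in> L" "z = k \<otimes>\<^bsub>S\<^esub> l"
  using assms by (auto simp: set_mult_def)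

lemma add_span_incl: "g \<in> G \<Longrightarrow> g \<in> add_span S G"
  by (simp add: add_span_def generate.incl)

context cring
begin

lemma set_mult_in_carrier: "K \<subseteq> carrier R \<Longrightarrow> L \<subseteq> carrier R \<Longrightarrow> K <#> L \<subseteq> carrier R"
  by (auto simp: set_mult_def)

lemma add_span_subgroup: "G \<subseteq> carrier R \<Longrightarrow> subgroup (add_span R G) (add_monoid R)"
  unfolding add_span_def by (rule add.generate_is_subgroup) simp

lemma add_span_in_carrier: "G \<subseteq> carrier R \<Longrightarrow> add_span R G \<subseteq> carrier R"
  using subgroup.subset[OF add_span_subgroup[of G]] by simp

lemma add_span_diff:
  assumes "G \<subseteq> carrier R" "x \<in> add_span R G" "y \<in> add_span R G"
  shows "x \<ominus> y \<in> add_span R G"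
proof -
  interpret H: subgroup "add_span R G" "add_monoid R" using assms(1) by (rule add_span_subgroup)
  show ?thesis
    using H.m_closed[OF assms(2) H.m_inv_closed[OF assms(3)]]
    by (simp add: a_minus_def a_inv_def)
qed

lemma add_span_least:
  assumes "\<And>g. g \<in> G \<Longrightarrow> g \<in> H" "subgroup H (add_monoid R)" "x \<in> add_span R G"
  shows "x \<in> H"
  using add.generate_subgroup_incl[of G H] assms by (auto simp: add_span_def)

text \<open>The map \<open>x \<mapsto> c \<phi>(x)\<close> is additive, so whether it carries one span into another can be
  tested on generators.  The factor \<open>c\<close> stands for the part of a coefficient that is left unchanged
  while the other part is expanded.\<close>

lemma add_span_image:
  assumes S: "cring S" and \<phi>: "\<phi> \<in> ring_hom S R" and c: "c \<in> carrier R"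
    and G: "G \<subseteq> carrier S" and H: "H \<subseteq> carrier R"
    and gen: "\<And>g. g \<in> G \<Longrightarrow> c \<otimes> \<phi> g \<in> add_span R H"
    and x: "x \<in> add_span S G"
  shows "c \<otimes> \<phi> x \<in> add_span R H"
proof -
  interpret S: cring S by fact
  interpret \<phi>: ring_hom_cring S R \<phi> by unfold_locales (fact \<phi>)
  interpret m: group_hom "add_monoid S" "add_monoid R" "\<lambda>x. c \<otimes> \<phi> x"
    using c by unfold_locales (auto simp: hom_def r_distr)
  let ?H = "{x \<in> carrier S. c \<otimes> \<phi> x \<in> add_span R H}"
  have "subgroup ?H (add_monoid S)"
  proof (rule S.add.subgroupI)
    interpret H: subgroup "add_span R H" "add_monoid R" using H by (rule add_span_subgroup)
    show "?H \<noteq> {}" using H.one_closed c by (auto intro!: exI[of _ "\<zero>\<^bsub>S\<^esub>"])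
    show "\<ominus>\<^bsub>S\<^esub> a \<in> ?H" if "a \<in> ?H" for a
      using that c H.m_inv_closed[of "c \<otimes> \<phi> a"] by (auto simp: r_minus a_inv_def[symmetric])
    show "a \<oplus>\<^bsub>S\<^esub> b \<in> ?H" if "a \<in> ?H" "b \<in> ?H" for a b
      using that c H.m_closed[of "c \<otimes> \<phi> a" "c \<otimes> \<phi> b"] by (auto simp: r_distr)
  qed auto
  from S.add_span_least[OF _ this x] show ?thesis using G gen by blast
qed

lemma add_span_mult:
  assumes "c \<in> carrier R" "G \<subseteq> carrier R" "H \<subseteq> carrier R"
    and "\<And>g. g \<in> G \<Longrightarrow> c \<otimes> g \<in> add_span R H" "x \<in> add_span R G"
  shows "c \<otimes> x \<in> add_span R H"
  using add_span_image[OF cring_axioms, of id c G H x] assms by (simp add: id_ring_hom)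

text \<open>The analogue of transitivity of finiteness in a tower of rings: the products of the two
  finite generating sets generate.\<close>

lemma finite_over_trans:
  assumes K: "finite_over R K" and X: "finite X" "X \<subseteq> carrier R" and L: "L \<subseteq> carrier R"
    and KL: "\<And>k. k \<in> K \<Longrightarrow> k \<in> add_span R (L <#> X)"
  shows "finite_over R L"
proof -
  obtain Y where Y: "finite Y" "Y \<subseteq> carrier R" "carrier R \<subseteq> add_span R (K <#> Y)"
    using K by (auto simp: finite_over_def)
  have LX: "L <#> X \<subseteq> carrier R" and XY: "X <#> Y \<subseteq> carrier R"
    using L X Y by (simp_all add: set_mult_in_carrier)
  have LXY: "L <#> (X <#> Y) \<subseteq> carrier R"
    using L XY by (rule set_mult_in_carrier)
  have "z \<in> add_span R (L <#> (X <#> Y))" if "z \<in> K <#> Y" for z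
    using that
  proof (rule set_mult_memE)
    fix k y assume k: "k \<in> K" and y: "y \<in> Y" and z: "z = k \<otimes> y"
    have yc: "y \<in> carrier R" and kc: "k \<in> carrier R"
      using y Y KL[OF k] add_span_in_carrier[OF LX] by auto
    have "y \<otimes> k \<in> add_span R (L <#> (X <#> Y))"
    proof (rule add_span_mult[OF yc LX LXY _ KL[OF k]])
      fix g assume "g \<in> L <#> X"
      then obtain l x where g: "l \<in> L" "x \<in> X" "g = l \<otimes> x" by (rule set_mult_memE)
      have "y \<otimes> g = l \<otimes> (x \<otimes> y)" using g yc L X by (auto simp: m_ac subset_iff)
      then show "y \<otimes> g \<in> add_span R (L <#> (X <#> Y))"
        using g y by (auto intro!: add_span_incl set_mult_memI)
    qed
    then show ?thesis using z kc yc by (simp add: m_comm)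
  qed
  then have "carrier R \<subseteq> add_span R (L <#> (X <#> Y))"
    using Y(3) add_span_least[OF _ add_span_subgroup[OF LXY]] by blast
  moreover have "finite (X <#> Y)" using X Y by (auto simp: set_mult_def)
  ultimately show ?thesis using XY unfolding finite_over_def by blast
qed

lemma mem_add_span_set_mult_one:
  assumes L: "L \<subseteq> carrier R" and l: "l \<in> L"
  shows "l \<in> add_span R (L <#> {\<one>})"
proof -
  have "l \<otimes> \<one> \<in> L <#> {\<one>}"
    using l by (rule set_mult_memI) simp
  moreover have "l \<otimes> \<one> = l" using subsetD[OF L l] by (rule r_one)
  ultimately show ?thesis using add_span_incl[of l "L <#> {\<one>}" R] by simp
qed

lemma finite_over_mono:
  assumes K: "finite_over R K" and KL: "K \<subseteq> L" and L: "L \<subseteq> carrier R"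
  shows "finite_over R L"
proof (rule finite_over_trans[OF K _ _ L])
  show "k \<in> add_span R (L <#> {\<one>})" if "k \<in> K" for k
    by (rule mem_add_span_set_mult_one[OF L subsetD[OF KL that]])
  show "finite {\<one>}" "{\<one>} \<subseteq> carrier R" by simp_all
qed

end

section \<open>Finite ring maps and additive spans\<close>

text \<open>For finite \<open>X\<close>, the linear combinations with exactly one coefficient for each element of
  \<open>X\<close> form a subgroup, since coefficients of the same generator can be collected.  This subgroup is
  therefore the additive span of the products of coefficients with generators.\<close>

lemma finite_ring_map_iff_finite_over:
  assumes R: "cring R" and S: "cring S" and \<phi>: "\<phi> \<in> ring_hom R S"
  shows "finite_ring_map R S \<phi> \<longleftrightarrow> finite_over S (\<phi> ` carrier R)"
proof -
  interpret R: cring R by fact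
  interpret S: cring S by fact
  interpret \<phi>: ring_hom_cring R S \<phi> by unfold_locales (fact \<phi>)
  let ?K = "\<phi> ` carrier R"
  let ?comb = "\<lambda>X c. \<Oplus>\<^bsub>S\<^esub>x\<in>X. \<phi> (c x) \<otimes>\<^bsub>S\<^esub> x"
  have K: "?K \<subseteq> carrier S" by auto
  have span_eq: "m \<in> add_span S (?K <#>\<^bsub>S\<^esub> X) \<longleftrightarrow> (\<exists>c \<in> X \<rightarrow> carrier R. m = ?comb X c)"
    if X: "finite X" "X \<subseteq> carrier S" for X m
  proof
    interpret H: subgroup "add_span S (?K <#>\<^bsub>S\<^esub> X)" "add_monoid S"
      by (intro S.add_span_subgroup S.set_mult_in_carrier K X)
    assume "\<exists>c \<in> X \<rightarrow> carrier R. m = ?comb X c"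
    then obtain c where c: "c \<in> X \<rightarrow> carrier R" and m: "m = ?comb X c" by blast
    have "?comb Y c \<in> add_span S (?K <#>\<^bsub>S\<^esub> X)" if "finite Y" "Y \<subseteq> X" for Y
      using that
    proof (induction Y)
      case empty
      then show ?case using H.one_closed by simp
    next
      case (insert y Y)
      have "\<phi> (c y) \<otimes>\<^bsub>S\<^esub> y \<in> add_span S (?K <#>\<^bsub>S\<^esub> X)"
        using insert.prems c by (auto intro!: add_span_incl set_mult_memI)
      moreover have "?comb (insert y Y) c = \<phi> (c y) \<otimes>\<^bsub>S\<^esub> y \<oplus>\<^bsub>S\<^esub> ?comb Y c"
      proof (subst S.finsum_insert)
        show "(\<lambda>x. \<phi> (c x) \<otimes>\<^bsub>S\<^esub> x) \<in> Y \<rightarrow> carrier S" "\<phi> (c y) \<otimes>\<^bsub>S\<^esub> y \<in> carrier S"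
          using insert.prems c X(2) by (blast intro: S.m_closed \<phi>.hom_closed)+
      qed (use insert.hyps in simp_all)
      ultimately show ?case using insert H.m_closed by simp
    qed
    with m X(1) show "m \<in> add_span S (?K <#>\<^bsub>S\<^esub> X)" by simp
  next
    let ?H = "{m. \<exists>c \<in> X \<rightarrow> carrier R. m = ?comb X c}"
    have cl: "?comb X c \<in> carrier S" if "c \<in> X \<rightarrow> carrier R" for c
      using that X by (intro S.finsum_closed) (auto simp: Pi_iff)
    \<comment> \<open>The sign is absorbed as the coefficient \<open>-1\<close>, so that distributivity of sums applies.\<close>
    have neg: "\<ominus>\<^bsub>S\<^esub> ?comb X c = ?comb X (\<lambda>x. \<ominus>\<^bsub>R\<^esub> \<one>\<^bsub>R\<^esub> \<otimes>\<^bsub>R\<^esub> c x)" if c: "c \<in> X \<rightarrow> carrier R" for c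
    proof -
      have "\<ominus>\<^bsub>S\<^esub> \<one>\<^bsub>S\<^esub> \<otimes>\<^bsub>S\<^esub> ?comb X c = (\<Oplus>\<^bsub>S\<^esub>x\<in>X. \<ominus>\<^bsub>S\<^esub> \<one>\<^bsub>S\<^esub> \<otimes>\<^bsub>S\<^esub> (\<phi> (c x) \<otimes>\<^bsub>S\<^esub> x))"
        using c X by (intro S.finsum_rdistr) (auto simp: Pi_iff)
      also have "\<dots> = ?comb X (\<lambda>x. \<ominus>\<^bsub>R\<^esub> \<one>\<^bsub>R\<^esub> \<otimes>\<^bsub>R\<^esub> c x)"
        using c X by (intro S.finsum_cong') (auto simp: Pi_iff S.m_assoc subset_iff)
      finally show ?thesis using cl[OF c] by (simp add: S.l_minus)
    qed
    have "subgroup ?H (add_monoid S)"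
    proof (rule S.add.subgroupI)
      show "?H \<noteq> {}" by (auto intro!: exI[of _ "?comb X (\<lambda>_. \<zero>\<^bsub>R\<^esub>)"] bexI[of _ "\<lambda>_. \<zero>\<^bsub>R\<^esub>"])
      show "\<ominus>\<^bsub>S\<^esub> a \<in> ?H" if a: "a \<in> ?H" for a
      proof -
        obtain c where "c \<in> X \<rightarrow> carrier R" "a = ?comb X c" using a by blast
        then show ?thesis
          using neg by (auto intro!: bexI[of _ "\<lambda>x. \<ominus>\<^bsub>R\<^esub> \<one>\<^bsub>R\<^esub> \<otimes>\<^bsub>R\<^esub> c x"])
      qed
      show "a \<oplus>\<^bsub>S\<^esub> b \<in> ?H" if a: "a \<in> ?H" and b: "b \<in> ?H" for a b
      proof -
        obtain c where c: "c \<in> X \<rightarrow> carrier R" "a = ?comb X c" using a by blast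
        obtain d where d: "d \<in> X \<rightarrow> carrier R" "b = ?comb X d" using b by blast
        note cd = c d
        have "a \<oplus>\<^bsub>S\<^esub> b = (\<Oplus>\<^bsub>S\<^esub>x\<in>X. \<phi> (c x) \<otimes>\<^bsub>S\<^esub> x \<oplus>\<^bsub>S\<^esub> \<phi> (d x) \<otimes>\<^bsub>S\<^esub> x)"
          unfolding cd using cd(1,3) X by (intro S.finsum_addf[symmetric]) (auto simp: Pi_iff)
        also have "\<dots> = ?comb X (\<lambda>x. c x \<oplus>\<^bsub>R\<^esub> d x)"
          using cd(1,3) X by (intro S.finsum_cong') (auto simp: Pi_iff S.l_distr subset_iff)
        finally show ?thesis
          using cd by (auto intro!: bexI[of _ "\<lambda>x. c x \<oplus>\<^bsub>R\<^esub> d x"])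
      qed
    qed (use cl in auto)
    moreover have "z \<in> ?H" if z: "z \<in> ?K <#>\<^bsub>S\<^esub> X" for z
    proof -
      obtain r x where r: "r \<in> carrier R" and x: "x \<in> X" and z: "z = \<phi> r \<otimes>\<^bsub>S\<^esub> x"
        using z by (auto elim: set_mult_memE)
      let ?c = "\<lambda>y. if y = x then r else \<zero>\<^bsub>R\<^esub>"
      have "?comb X ?c = ?comb {x} ?c"
        using r x X by (intro S.add.finprod_mono_neutral_cong_right) (auto simp: subset_iff)
      also have "\<dots> = z" using r x X z by (auto simp: subset_iff)
      finally show ?thesis using r by (auto intro!: bexI[of _ ?c])
    qed
    ultimately show "\<exists>c \<in> X \<rightarrow> carrier R. m = ?comb X c" if "m \<in> add_span S (?K <#>\<^bsub>S\<^esub> X)"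
      using S.add_span_least[OF _ _ that, of ?H] by blast
  qed
  \<comment> \<open>\<open>hom_module\<close> has the additive structure of \<open>S\<close>, so both sums are literally the same fold.\<close>
  have sum_eq: "(\<Oplus>\<^bsub>hom_module \<phi> S\<^esub>x\<in>X. c x \<odot>\<^bsub>hom_module \<phi> S\<^esub> x) = ?comb X c" for X c
    by (simp add: finsum_def finprod_def hom_module_def)
  show ?thesis
    unfolding finite_ring_map_def fin_gen_module_def finite_over_def sum_eq
    by (auto simp: hom_module_def span_eq subset_iff)
qed

section \<open>The image of the relative Frobenius\<close>

text \<open>The values of \<open>\<Phi>\<^sub>e(A, B)\<close> on pure tensors: a multiplicatively closed set whose additive span
  is the image of \<open>\<Phi>\<^sub>e(A, B)\<close>.\<close>

definition frob_multiples :: "nat \<Rightarrow> nat \<Rightarrow> ('a, 'm) ring_scheme \<Rightarrow> ('b, 'n) ring_scheme \<Rightarrow>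
    ('a \<Rightarrow> 'b) \<Rightarrow> 'b set" where
  "frob_multiples p e A B f = frob p e B ` carrier B <#>\<^bsub>B\<^esub> f ` carrier A"

lemma F_finite_ring_iff:
  assumes "prime p" "Fp_algebra p A"
  shows "F_finite_ring p A \<longleftrightarrow> finite_over A (frob p 1 A ` carrier A)"
  unfolding F_finite_ring_def
  using assms by (intro finite_ring_map_iff_finite_over frob_char) (auto simp: Fp_algebra_def)

lemma frob_Suc:
  assumes "Fp_algebra p A" "a \<in> carrier A"
  shows "frob p (Suc e) A a = frob p 1 A (frob p e A a)"
proof -
  interpret cring A using assms by (simp add: Fp_algebra_def)
  show ?thesis using assms(2) by (simp add: frob_def nat_pow_pow mult.commute)
qed

context Fp_algebra_map
begin

interpretation A: cring A using A by (simp add: Fp_algebra_def)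
interpretation B: cring B using B by (simp add: Fp_algebra_def)
interpretation f: ring_hom_cring A B f by unfold_locales (fact f)

lemma frob_closed: "b \<in> carrier B \<Longrightarrow> frob p e B b \<in> carrier B"
  by (simp add: frob_def)

lemma frob_multiplesI:
  "b \<in> carrier B \<Longrightarrow> a \<in> carrier A \<Longrightarrow> frob p e B b \<otimes>\<^bsub>B\<^esub> f a \<in> frob_multiples p e A B f"
  by (auto simp: frob_multiples_def intro: set_mult_memI)

lemma frob_multiplesE:
  assumes "z \<in> frob_multiples p e A B f"
  obtains b a where "b \<in> carrier B" "a \<in> carrier A" "z = frob p e B b \<otimes>\<^bsub>B\<^esub> f a"
  using assms by (auto simp: frob_multiples_def set_mult_def)

lemma frob_multiples_in_carrier: "frob_multiples p e A B f \<subseteq> carrier B"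
  unfolding frob_multiples_def by (rule B.set_mult_in_carrier) (auto simp: frob_closed)

lemma frob_hom_commute: "a \<in> carrier A \<Longrightarrow> frob p e B (f a) = f (frob p e A a)"
  by (simp add: frob_def)

text \<open>The bridge away from tensor products.  One direction is monotonicity; the other holds
  because every tensor is a combination of pure tensors, so the image of \<open>\<Phi>\<^sub>e(A, B)\<close> lies in the
  span of the set of multiples.\<close>

lemma rel_frob_finite_iff:
  "rel_frob_finite p e A B f \<longleftrightarrow> finite_over B (frob_multiples p e A B f)"
proof -
  interpret tensor A B A f "frob p e A" by (rule tensor_rel_frob)
  let ?\<Phi> = "rel_frob p e B f" and ?M = "frob_multiples p e A B f"
  have hom: "?\<Phi> \<in> ring_hom P B" using rel_frob_hom by (simp add: rel_frob_dom_def)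
  interpret \<Phi>: ring_hom_cring P B ?\<Phi> by unfold_locales (fact hom)
  have M_image: "?M \<subseteq> ?\<Phi> ` carrier P"
    by (auto elim!: frob_multiplesE simp: frob_def rel_frob_pure[symmetric])
  have M1: "?M <#>\<^bsub>B\<^esub> {\<one>\<^bsub>B\<^esub>} \<subseteq> carrier B"
    using frob_multiples_in_carrier by (intro B.set_mult_in_carrier) auto
  have image_span: "?\<Phi> z \<in> add_span B (?M <#>\<^bsub>B\<^esub> {\<one>\<^bsub>B\<^esub>})" if "z \<in> carrier P" for z
    using that
  proof (induction z rule: P_induct)
    case (pure b a)
    then show ?case
      using frob_multiplesI[of b a e]
      by (auto simp: rel_frob_pure frob_def intro!: B.mem_add_span_set_mult_one frob_multiples_in_carrier)
  next
    case (diff y z)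
    have "?\<Phi> (y \<ominus>\<^bsub>P\<^esub> z) = ?\<Phi> y \<ominus>\<^bsub>B\<^esub> ?\<Phi> z"
      using diff(1,2) by (simp add: a_minus_def)
    with B.add_span_diff[OF M1 diff(3,4)] show ?case by simp
  qed
  have "rel_frob_finite p e A B f \<longleftrightarrow> finite_over B (?\<Phi> ` carrier P)"
    unfolding rel_frob_finite_def rel_frob_dom_def
    by (rule finite_ring_map_iff_finite_over[OF P.cring_axioms B.cring_axioms hom])
  also have "\<dots> \<longleftrightarrow> finite_over B ?M"
  proof
    assume "finite_over B (?\<Phi> ` carrier P)"
    then show "finite_over B ?M"
      by (rule B.finite_over_trans[where X = "{\<one>\<^bsub>B\<^esub>}"])
         (use image_span frob_multiples_in_carrier in auto)
  next
    assume "finite_over B ?M"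
    then show "finite_over B (?\<Phi> ` carrier P)"
      by (rule B.finite_over_mono[OF _ M_image]) auto
  qed
  finally show ?thesis .
qed

section \<open>Independence of the exponent\<close>

text \<open>Frobenius is applied to an expression of \<open>b\<close> in terms of generators for exponent \<open>e\<close>; this
  writes \<open>b\<^sup>p\<close> in terms of generators for exponent \<open>e + 1\<close>, with \<open>p\<close>-th powers of the old
  module generators as the new ones.\<close>

lemma rel_frob_finite_Suc:
  assumes 1: "rel_frob_finite p 1 A B f" and e: "rel_frob_finite p e A B f"
  shows "rel_frob_finite p (Suc e) A B f"
proof -
  let ?M = "frob_multiples p (Suc e) A B f"
  obtain X where X: "finite X" "X \<subseteq> carrier B"
    and BX: "carrier B \<subseteq> add_span B (frob_multiples p e A B f <#>\<^bsub>B\<^esub> X)"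
    using e by (auto simp: rel_frob_finite_iff finite_over_def)
  let ?X = "frob p 1 B ` X"
  have X': "finite ?X" "?X \<subseteq> carrier B" using X by (auto simp: frob_closed)
  have MX: "frob_multiples p e A B f <#>\<^bsub>B\<^esub> X \<subseteq> carrier B" "?M <#>\<^bsub>B\<^esub> ?X \<subseteq> carrier B"
    using X X' by (simp_all add: B.set_mult_in_carrier frob_multiples_in_carrier)
  have "finite_over B ?M"
  proof (rule B.finite_over_trans[OF 1[unfolded rel_frob_finite_iff] X' frob_multiples_in_carrier])
    fix k assume "k \<in> frob_multiples p 1 A B f"
    then obtain b a where k: "b \<in> carrier B" "a \<in> carrier A" "k = frob p 1 B b \<otimes>\<^bsub>B\<^esub> f a"
      by (rule frob_multiplesE)
    \<comment> \<open>Frobenius carries the span containing \<open>b\<close> into the new one, even after multiplying by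
      \<open>f(a)\<close>, because \<open>f(A)\<close> is closed under multiplication.\<close>
    have "f a \<otimes>\<^bsub>B\<^esub> frob p 1 B b \<in> add_span B (?M <#>\<^bsub>B\<^esub> ?X)"
    proof (rule B.add_span_image[OF B.cring_axioms frob_char[OF p B] _ MX])
      fix g assume "g \<in> frob_multiples p e A B f <#>\<^bsub>B\<^esub> X"
      then obtain m x where "m \<in> frob_multiples p e A B f" and x: "x \<in> X" and g: "g = m \<otimes>\<^bsub>B\<^esub> x"
        by (rule set_mult_memE)
      then obtain b' a' where m: "b' \<in> carrier B" "a' \<in> carrier A" "m = frob p e B b' \<otimes>\<^bsub>B\<^esub> f a'"
        by (auto elim: frob_multiplesE)
      have c: "frob p 1 B x \<in> carrier B" "frob p 1 A a' \<in> carrier A" "frob p (Suc e) B b' \<in> carrier B"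
        using x X m by (auto simp: frob_def)
      have "frob p 1 B g = frob p (Suc e) B b' \<otimes>\<^bsub>B\<^esub> f (frob p 1 A a') \<otimes>\<^bsub>B\<^esub> frob p 1 B x"
        using ring_hom_mult[OF frob_char[OF p B, of 1]] m x X
        by (simp add: g frob_closed frob_Suc[OF B, of b' e] frob_hom_commute subset_iff)
      then have eq: "f a \<otimes>\<^bsub>B\<^esub> frob p 1 B g =
          (frob p (Suc e) B b' \<otimes>\<^bsub>B\<^esub> f (a \<otimes> frob p 1 A a')) \<otimes>\<^bsub>B\<^esub> frob p 1 B x"
        using k c by (simp add: B.m_ac)
      show "f a \<otimes>\<^bsub>B\<^esub> frob p 1 B g \<in> add_span B (?M <#>\<^bsub>B\<^esub> ?X)"
        unfolding eq
        by (intro add_span_incl set_mult_memI frob_multiplesI imageI A.m_closed m(1) k(2) c(2) x)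
    qed (use k BX in auto)
    then show "k \<in> add_span B (?M <#>\<^bsub>B\<^esub> ?X)"
      using k by (simp add: B.m_comm frob_closed)
  qed
  then show ?thesis by (simp add: rel_frob_finite_iff)
qed

lemma rel_frob_finite_all:
  assumes "rel_frob_finite p 1 A B f" "e > 0"
  shows "rel_frob_finite p e A B f"
  using assms(2)
proof (induction e)
  case (Suc e)
  then show ?case using rel_frob_finite_Suc assms(1) by (cases "e = 0") auto
qed simp

lemma rel_frob_finite_one:
  assumes "rel_frob_finite p e A B f" "e > 0"
  shows "rel_frob_finite p 1 A B f"
proof -
  obtain d where e: "e = Suc d" using assms(2) by (cases e) auto
  have "frob_multiples p e A B f \<subseteq> frob_multiples p 1 A B f"
    by (auto elim!: frob_multiplesE simp: e frob_Suc[OF B, of _ d] frob_closed intro!: frob_multiplesI)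
  then show ?thesis
    using assms(1) B.finite_over_mono frob_multiples_in_carrier by (simp add: rel_frob_finite_iff)
qed

end

section \<open>Composition and cancellation\<close>

lemma F_finite_iff_finite_over:
  assumes "Fp_algebra_map p A B f"
  shows "F_finite p A B f \<longleftrightarrow> finite_over B (frob_multiples p 1 A B f)"
  using Fp_algebra_map.rel_frob_finite_iff[OF assms] by (simp add: F_finite_def)

lemma F_finite_comp:
  assumes "Fp_algebra_map p A B f" "Fp_algebra_map p B C g"
    and "F_finite p A B f" "F_finite p B C g"
  shows "F_finite p A C (g \<circ> f)"
proof -
  interpret f: Fp_algebra_map p A B f by fact
  interpret g: Fp_algebra_map p B C g by fact
  interpret gf: Fp_algebra_map p A C "g \<circ> f"
    by unfold_locales (auto intro: f.p f.A g.B ring_hom_trans[OF f.f g.f])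
  interpret B: cring B using f.B by (simp add: Fp_algebra_def)
  interpret C: cring C using g.B by (simp add: Fp_algebra_def)
  interpret gh: ring_hom_cring B C g by unfold_locales (fact g.f)
  let ?M = "frob_multiples p 1 A C (g \<circ> f)"
  obtain X where X: "finite X" "X \<subseteq> carrier B"
    and BX: "carrier B \<subseteq> add_span B (frob_multiples p 1 A B f <#>\<^bsub>B\<^esub> X)"
    using assms(3) F_finite_iff_finite_over[OF assms(1)] by (auto simp: finite_over_def)
  have X': "finite (g ` X)" "g ` X \<subseteq> carrier C" using X by auto
  have MX: "frob_multiples p 1 A B f <#>\<^bsub>B\<^esub> X \<subseteq> carrier B" "?M <#>\<^bsub>C\<^esub> g ` X \<subseteq> carrier C"
    using X X' by (simp_all add: B.set_mult_in_carrier C.set_mult_in_carrier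
        f.frob_multiples_in_carrier gf.frob_multiples_in_carrier)
  have "finite_over C (frob_multiples p 1 B C g)"
    using assms(4) F_finite_iff_finite_over[OF assms(2)] by simp
  then have "finite_over C ?M"
  proof (rule C.finite_over_trans[OF _ X' gf.frob_multiples_in_carrier])
    fix k assume "k \<in> frob_multiples p 1 B C g"
    then obtain c b where k: "c \<in> carrier C" "b \<in> carrier B" "k = frob p 1 C c \<otimes>\<^bsub>C\<^esub> g b"
      by (rule g.frob_multiplesE)
    \<comment> \<open>Here \<open>b\<close> is expanded over \<open>B\<^sup>p f(A) X\<close>; the \<open>p\<close>-th powers \<open>g(b')\<^sup>p\<close> that appear merge
      with \<open>c\<^sup>p\<close>.\<close>
    have "frob p 1 C c \<otimes>\<^bsub>C\<^esub> g b \<in> add_span C (?M <#>\<^bsub>C\<^esub> g ` X)"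
    proof (rule C.add_span_image[OF B.cring_axioms g.f _ MX])
      fix z assume "z \<in> frob_multiples p 1 A B f <#>\<^bsub>B\<^esub> X"
      then obtain m x where "m \<in> frob_multiples p 1 A B f" and x: "x \<in> X" and z: "z = m \<otimes>\<^bsub>B\<^esub> x"
        by (rule set_mult_memE)
      then obtain b' a where m: "b' \<in> carrier B" "a \<in> carrier A" "m = frob p 1 B b' \<otimes>\<^bsub>B\<^esub> f a"
        by (auto elim: f.frob_multiplesE)
      have c: "g x \<in> carrier C" "f a \<in> carrier B" "frob p 1 C c \<in> carrier C" "frob p 1 C (g b') \<in> carrier C"
        "frob p 1 B b' \<in> carrier B"  "x \<in> carrier B"
        using x X m k ring_hom_closed[OF f.f] by (auto simp: frob_def)
      have "frob p 1 C c \<otimes>\<^bsub>C\<^esub> g z = (frob p 1 C c \<otimes>\<^bsub>C\<^esub> frob p 1 C (g b') \<otimes>\<^bsub>C\<^esub> g (f a)) \<otimes>\<^bsub>C\<^esub> g x"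
        using m c by (simp add: z g.frob_hom_commute C.m_assoc)
      also have "frob p 1 C c \<otimes>\<^bsub>C\<^esub> frob p 1 C (g b') = frob p 1 C (c \<otimes>\<^bsub>C\<^esub> g b')"
        using ring_hom_mult[OF frob_char[OF f.p g.B]] k m by simp
      finally show "frob p 1 C c \<otimes>\<^bsub>C\<^esub> g z \<in> add_span C (?M <#>\<^bsub>C\<^esub> g ` X)"
        using k m x gf.frob_multiplesI[of "c \<otimes>\<^bsub>C\<^esub> g b'" a 1]
        by (auto intro!: add_span_incl set_mult_memI)
    qed (use k BX in \<open>auto simp: g.frob_closed\<close>)
    with k show "k \<in> add_span C (?M <#>\<^bsub>C\<^esub> g ` X)" by simp
  qed
  then show ?thesis using F_finite_iff_finite_over[OF gf.Fp_algebra_map_axioms] by simp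
qed

text \<open>Enlarging the base ring from \<open>A\<close> to \<open>B\<close> only enlarges the set of coefficients.\<close>

lemma F_finite_comp_right:
  assumes "Fp_algebra_map p A B f" "Fp_algebra_map p B C g" "F_finite p A C (g \<circ> f)"
  shows "F_finite p B C g"
proof -
  interpret f: Fp_algebra_map p A B f by fact
  interpret g: Fp_algebra_map p B C g by fact
  interpret gf: Fp_algebra_map p A C "g \<circ> f"
    by unfold_locales (auto intro: f.p f.A g.B ring_hom_trans[OF f.f g.f])
  interpret C: cring C using g.B by (simp add: Fp_algebra_def)
  have "frob_multiples p 1 A C (g \<circ> f) \<subseteq> frob_multiples p 1 B C g"
    using ring_hom_closed[OF f.f] by (auto elim!: gf.frob_multiplesE intro!: g.frob_multiplesI)
  then show ?thesis
    using assms(3) C.finite_over_mono g.frob_multiples_in_carrier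
      F_finite_iff_finite_over[OF gf.Fp_algebra_map_axioms] F_finite_iff_finite_over[OF assms(2)]
    by simp
qed

section \<open>Absolute and relative finiteness of Frobenius\<close>

lemma Fp_algebra_Fp:
  assumes "prime p" shows "Fp_algebra p (Fp p)"
proof -
  interpret residues "int p" "Fp p"
    using prime_gt_1_nat[OF assms] by (auto simp: residues_def)
  have "id \<in> ring_hom (Fp p) (Fp p)" by (rule id_ring_hom)
  then show ?thesis using cring_axioms unfolding Fp_algebra_def by blast
qed

text \<open>Both \<open>\<iota>\<close> and Frobenius after \<open>\<iota>\<close> are homomorphisms from \<open>\<bbbF>\<^sub>p\<close> to \<open>A\<close>, so they agree, and
  scalars from \<open>\<bbbF>\<^sub>p\<close> are \<open>p\<close>-th powers already.  Hence the relative and the absolute Frobenius have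
  the same coefficient set.\<close>

lemma F_finite_ring_iff_F_finite:
  assumes p: "prime p" and A: "Fp_algebra p A" and \<iota>: "\<iota> \<in> ring_hom (Fp p) A"
  shows "F_finite_ring p A \<longleftrightarrow> F_finite p (Fp p) A \<iota>"
proof -
  interpret \<iota>: Fp_algebra_map p "Fp p" A \<iota>
    by unfold_locales (use assms Fp_algebra_Fp in auto)
  interpret A: cring A using A by (simp add: Fp_algebra_def)
  interpret K: cring "Fp p" using \<iota>.A by (simp add: Fp_algebra_def)
  have frob: "frob p 1 A \<in> ring_hom A A" using p A by (rule frob_char)
  have \<iota>_frob: "\<iota> n = frob p 1 A (\<iota> n)" if "n \<in> carrier (Fp p)" for n
    using Fp_hom_unique[OF p A.cring_axioms \<iota> ring_hom_trans[OF \<iota> frob] that] by simp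
  have "frob_multiples p 1 (Fp p) A \<iota> = frob p 1 A ` carrier A"
  proof (intro equalityI subsetI)
    fix z assume "z \<in> frob_multiples p 1 (Fp p) A \<iota>"
    then obtain a n where z: "a \<in> carrier A" "n \<in> carrier (Fp p)" "z = frob p 1 A a \<otimes>\<^bsub>A\<^esub> \<iota> n"
      by (rule \<iota>.frob_multiplesE)
    have n: "\<iota> n \<in> carrier A" using z(2) by (rule ring_hom_closed[OF \<iota>])
    have "z = frob p 1 A (a \<otimes>\<^bsub>A\<^esub> \<iota> n)"
      unfolding z(3) ring_hom_mult[OF frob z(1) n] by (subst \<iota>_frob[OF z(2)]) simp
    then show "z \<in> frob p 1 A ` carrier A" using z(1) n by auto
  next
    fix z assume "z \<in> frob p 1 A ` carrier A"
    then obtain a where "a \<in> carrier A" "z = frob p 1 A a" by blast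
    then show "z \<in> frob_multiples p 1 (Fp p) A \<iota>"
      using \<iota>.frob_multiplesI[of a "\<one>\<^bsub>Fp p\<^esub>" 1] K.one_closed \<iota>.frob_closed
      by (simp add: ring_hom_one[OF \<iota>])
  qed
  then show ?thesis
    using F_finite_ring_iff[OF p A] F_finite_iff_finite_over[OF \<iota>.Fp_algebra_map_axioms] by simp
qed

lemma F_finite_of_F_finite_ring:
  assumes map: "Fp_algebra_map p A B f" and fin: "F_finite_ring p B"
  shows "F_finite p A B f"
proof -
  interpret f: Fp_algebra_map p A B f by fact
  obtain \<iota> where \<iota>: "\<iota> \<in> ring_hom (Fp p) A" using f.A by (auto simp: Fp_algebra_def)
  have \<iota>_map: "Fp_algebra_map p (Fp p) A \<iota>"
    by unfold_locales (rule f.p Fp_algebra_Fp f.A \<iota>)+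
  have "F_finite p (Fp p) B (f \<circ> \<iota>)"
    using F_finite_ring_iff_F_finite[OF f.p f.B ring_hom_trans[OF \<iota> f.f]] fin by simp
  then show ?thesis by (rule F_finite_comp_right[OF \<iota>_map map])
qed

lemma F_finite_ring_of_F_finite:
  assumes map: "Fp_algebra_map p A B f" and "F_finite_ring p A" "F_finite p A B f"
  shows "F_finite_ring p B"
proof -
  interpret f: Fp_algebra_map p A B f by fact
  obtain \<iota> where \<iota>: "\<iota> \<in> ring_hom (Fp p) A" using f.A by (auto simp: Fp_algebra_def)
  have \<iota>_map: "Fp_algebra_map p (Fp p) A \<iota>"
    by unfold_locales (rule f.p Fp_algebra_Fp f.A \<iota>)+
  have "F_finite p (Fp p) A \<iota>"
    using F_finite_ring_iff_F_finite[OF f.p f.A \<iota>] assms(2) by simp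
  then have "F_finite p (Fp p) B (f \<circ> \<iota>)" using assms(3) by (rule F_finite_comp[OF \<iota>_map map])
  then show ?thesis
    using F_finite_ring_iff_F_finite[OF f.p f.B ring_hom_trans[OF \<iota> f.f]] by simp
qed

section \<open>Base change\<close>

text \<open>A pure tensor \<open>s \<otimes> t\<close> is \<open>s \<otimes> 1\<close> times the image of \<open>t\<close>.  Expanding \<open>t\<close> in terms of the
  generators of \<open>T\<close> over \<open>R\<close> and moving the coefficients from \<open>R\<close> across the tensor sign expresses it
  by the images of the same generators.\<close>

lemma (in tensor) F_finite_base_change:
  assumes map: "Fp_algebra_map p R T \<psi>" and S: "Fp_algebra p S" and fin: "F_finite p R T \<psi>"
  shows "F_finite p S P (\<lambda>s. s \<otimes>\<^sub>t \<one>\<^bsub>T\<^esub>)"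
proof -
  interpret f: Fp_algebra_map p R T \<psi> by fact
  interpret l: Fp_algebra_map p S P "\<lambda>x. x \<otimes>\<^sub>t \<one>\<^bsub>T\<^esub>"
    by unfold_locales (rule f.p S Fp_algebra_hom[OF S P.cring_axioms in_left_hom] in_left_hom)+
  interpret r: Fp_algebra_map p T P "\<lambda>x. \<one>\<^bsub>S\<^esub> \<otimes>\<^sub>t x"
    by unfold_locales (rule f.p f.B l.B in_right_hom)+
  let ?M = "frob_multiples p 1 S P (\<lambda>x. x \<otimes>\<^sub>t \<one>\<^bsub>T\<^esub>)"
  obtain X where X: "finite X" "X \<subseteq> carrier T"
    and BX: "carrier T \<subseteq> add_span T (frob_multiples p 1 R T \<psi> <#>\<^bsub>T\<^esub> X)"
    using fin F_finite_iff_finite_over[OF map] by (auto simp: finite_over_def)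
  let ?X = "(\<lambda>x. \<one>\<^bsub>S\<^esub> \<otimes>\<^sub>t x) ` X"
  have X': "finite ?X" "?X \<subseteq> carrier P" using X by auto
  have MX: "?M <#>\<^bsub>P\<^esub> ?X \<subseteq> carrier P"
    using X' l.frob_multiples_in_carrier by (intro P.set_mult_in_carrier)
  have FX: "frob_multiples p 1 R T \<psi> <#>\<^bsub>T\<^esub> X \<subseteq> carrier T"
    using X f.frob_multiples_in_carrier by (intro T.set_mult_in_carrier)
  have span_pure:
    "s \<otimes>\<^sub>t t \<in> add_span P (?M <#>\<^bsub>P\<^esub> ?X)" if s: "s \<in> carrier S" and t: "t \<in> carrier T" for s t
  proof -
    have "(s \<otimes>\<^sub>t \<one>\<^bsub>T\<^esub>) \<otimes>\<^bsub>P\<^esub> (\<one>\<^bsub>S\<^esub> \<otimes>\<^sub>t t) \<in> add_span P (?M <#>\<^bsub>P\<^esub> ?X)"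
    proof (rule P.add_span_image[OF T.cring_axioms in_right_hom _ FX MX])
      fix z assume "z \<in> frob_multiples p 1 R T \<psi> <#>\<^bsub>T\<^esub> X"
      then obtain m x where "m \<in> frob_multiples p 1 R T \<psi>" and x: "x \<in> X" and z: "z = m \<otimes>\<^bsub>T\<^esub> x"
        by (rule set_mult_memE)
      then obtain t' r where m: "t' \<in> carrier T" "r \<in> carrier R" "m = frob p 1 T t' \<otimes>\<^bsub>T\<^esub> \<psi> r"
        by (auto elim: f.frob_multiplesE)
      have c: "x \<in> carrier T" "frob p 1 T t' \<in> carrier T" using x X m by (auto simp: frob_def)
      have "(s \<otimes>\<^sub>t \<one>\<^bsub>T\<^esub>) \<otimes>\<^bsub>P\<^esub> (\<one>\<^bsub>S\<^esub> \<otimes>\<^sub>t z) = s \<otimes>\<^sub>t (\<psi> r \<otimes>\<^bsub>T\<^esub> (frob p 1 T t' \<otimes>\<^bsub>T\<^esub> x))"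
        using s m c by (simp add: z pure_mult T.m_ac)
      also have "\<dots> = (\<phi> r \<otimes>\<^bsub>S\<^esub> s) \<otimes>\<^sub>t (frob p 1 T t' \<otimes>\<^bsub>T\<^esub> x)"
        using s m c by (intro pure_balanced[symmetric]) auto
      also have "\<dots> = ((\<one>\<^bsub>S\<^esub> \<otimes>\<^sub>t frob p 1 T t') \<otimes>\<^bsub>P\<^esub> ((\<phi> r \<otimes>\<^bsub>S\<^esub> s) \<otimes>\<^sub>t \<one>\<^bsub>T\<^esub>)) \<otimes>\<^bsub>P\<^esub> (\<one>\<^bsub>S\<^esub> \<otimes>\<^sub>t x)"
        using s m c by (simp add: pure_mult)
      also have "\<one>\<^bsub>S\<^esub> \<otimes>\<^sub>t frob p 1 T t' = frob p 1 P (\<one>\<^bsub>S\<^esub> \<otimes>\<^sub>t t')"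
        using m by (simp add: r.frob_hom_commute)
      finally show "(s \<otimes>\<^sub>t \<one>\<^bsub>T\<^esub>) \<otimes>\<^bsub>P\<^esub> (\<one>\<^bsub>S\<^esub> \<otimes>\<^sub>t z) \<in> add_span P (?M <#>\<^bsub>P\<^esub> ?X)"
        using s m x l.frob_multiplesI[of "\<one>\<^bsub>S\<^esub> \<otimes>\<^sub>t t'" "\<phi> r \<otimes>\<^bsub>S\<^esub> s" 1]
        by (auto intro!: add_span_incl set_mult_memI)
    qed (use s t BX in auto)
    then show ?thesis using s t by (simp add: pure_mult)
  qed
  have "z \<in> add_span P (?M <#>\<^bsub>P\<^esub> ?X)" if "z \<in> carrier P" for z
    using that
  proof (induction z rule: P_induct)
    case (pure s t)
    then show ?case by (rule span_pure)
  next
    case (diff y z)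
    from MX diff(3,4) show ?case by (rule P.add_span_diff)
  qed
  then have "finite_over P ?M" using X' by (auto simp: finite_over_def)
  then show ?thesis using F_finite_iff_finite_over[OF l.Fp_algebra_map_axioms] by simp
qed


section \<open>The properties of F-finite maps\<close>

theorem lemma2:
  fixes p :: nat
    and A :: "('a, 'k) ring_scheme" and B :: "('b, 'l) ring_scheme"
    and C :: "('c, 'm) ring_scheme" and A' :: "('d, 'n) ring_scheme"
    and f :: "'a \<Rightarrow> 'b" and g :: "'b \<Rightarrow> 'c" and h :: "'a \<Rightarrow> 'd"
  assumes "prime p"
    and "Fp_algebra p A" and "Fp_algebra p B" and "Fp_algebra p C" and "Fp_algebra p A'"
    and "f \<in> ring_hom A B" and "g \<in> ring_hom B C" and "h \<in> ring_hom A A'"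
  shows
    "((F_finite p A B f \<longleftrightarrow> (\<forall>e>0. rel_frob_finite p e A B f)) \<and>
      (F_finite p A B f \<longleftrightarrow> (\<exists>e>0. rel_frob_finite p e A B f))) \<and>
     (F_finite p A B f \<and> F_finite p B C g \<longrightarrow> F_finite p A C (g \<circ> f)) \<and>
     (F_finite p A C (g \<circ> f) \<longrightarrow> F_finite p B C g) \<and>
     (\<forall>\<iota> \<in> ring_hom (Fp p) A. F_finite_ring p A \<longleftrightarrow> F_finite p (Fp p) A \<iota>) \<and>
     (F_finite p A B f \<longrightarrow> F_finite p A' (tensor_ring A A' B h f) (\<lambda>x. pure_tensor A A' B h f x \<one>\<^bsub>B\<^esub>)) \<and>
     (F_finite_ring p B \<longrightarrow> F_finite p A B f) \<and>
     (F_finite_ring p A \<and> F_finite p A B f \<longrightarrow> F_finite_ring p B)"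
proof -
  have f: "Fp_algebra_map p A B f" and g: "Fp_algebra_map p B C g"
    using assms by (simp_all add: Fp_algebra_map_def)
  have h: "tensor A A' B h f"
    using assms by (simp add: tensor_def tensor_axioms_def Fp_algebra_def)
  have all: "\<forall>e>0. rel_frob_finite p e A B f" if "F_finite p A B f"
    using Fp_algebra_map.rel_frob_finite_all[OF f that[unfolded F_finite_def]] by simp
  have one: "F_finite p A B f" if "rel_frob_finite p e A B f" "e > 0" for e
    unfolding F_finite_def by (rule Fp_algebra_map.rel_frob_finite_one[OF f that])
  show ?thesis
  proof (intro conjI)
    show "F_finite p A B f \<longleftrightarrow> (\<forall>e>0. rel_frob_finite p e A B f)"
      using all one[of 1] by auto
    show "F_finite p A B f \<longleftrightarrow> (\<exists>e>0. rel_frob_finite p e A B f)"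
      using all one zero_less_one by blast
    show "F_finite p A B f \<and> F_finite p B C g \<longrightarrow> F_finite p A C (g \<circ> f)"
      using F_finite_comp[OF f g] by simp
    show "F_finite p A C (g \<circ> f) \<longrightarrow> F_finite p B C g"
      using F_finite_comp_right[OF f g] by simp
    show "\<forall>\<iota> \<in> ring_hom (Fp p) A. F_finite_ring p A \<longleftrightarrow> F_finite p (Fp p) A \<iota>"
      using F_finite_ring_iff_F_finite[OF assms(1,2)] by simp
    show "F_finite p A B f \<longrightarrow> F_finite p A' (tensor_ring A A' B h f) (\<lambda>x. pure_tensor A A' B h f x \<one>\<^bsub>B\<^esub>)"
      using tensor.F_finite_base_change[OF h f assms(5)] by simp
    show "F_finite_ring p B \<longrightarrow> F_finite p A B f"
      using F_finite_of_F_finite_ring[OF f] by simp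
    show "F_finite_ring p A \<and> F_finite p A B f \<longrightarrow> F_finite_ring p B"
      using F_finite_ring_of_F_finite[OF f] by simp
  qed
qed

end
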